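(* Let $k \geq 12$ be an integer with $k \equiv 0 \pmod 4$. (a) Let $A_k(n)$ denote the number of changes of sign in the sequence $\{\beta_k(m)\}_{m=0}^n$, and let $z_k = x_k + i y_k \in \mathbb{F}$ be the zero of $E_k$ in $\mathbb{F}$ with the largest imaginary part. Then $\lim_{n\to\infty} \frac{A_k(n)}{n} = 2x_k$. (b) Let $B_k(n)$ be the number of non-zero coefficients among $\{\beta_k(m)\}_{m=0}^{n-1}$. Then $\limsup_{n\to\infty} \frac{n}{B_k(n)} \leq 2$.
   Context: For an even integer $k \geq 4$, $B_k$ is the $k$-th Bernoulli number, $\sigma_\ell(n)=\sum_{d\mid n}d^\ell$, and $\mathrm{E}_k(q) = 1 - \frac{2k}{B_k}\sum_{n\ge1}\sigma_{k-1}(n)q^n$; the Eisenstein series is $E_k(z) = \mathrm{E}_k(e^{2\pi i z})$ for $z$ in the upper half plane $\mathbb{H}$. $\beta_k(n)$ are the (real) coefficients of the expansion of $1/\mathrm{E}_k(q)$ around $q=0$. The standard fundamental domain is $\mathbb{F} = \{z\in\mathbb{H} : |z|\ge 1,\ 0 \le \mathrm{Re}(z) \le 1/2\} \cup \{z \in \mathbb{H}: |z|>1,\ -1/2 < \mathrm{Re}(z) < 0\}$. The number of changes of sign of a finite sequence of real numbers is the number of sign changes between consecutive terms after all zero terms have been removed. *)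

theory Defs
  imports "HOL-Complex_Analysis.Complex_Analysis"
begin

text \<open>The exponential generating function is $x/(e^x-1)$; the division of formal power series
  is exact because numerator and denominator both have order of vanishing one at $x=0$.\<close>

definition bernoulli :: "nat \<Rightarrow> real" where
  "bernoulli n = fact n * fps_nth (fps_X / (fps_exp 1 - 1)) n"

definition divisor_sum :: "nat \<Rightarrow> nat \<Rightarrow> nat" where
  "divisor_sum l n = (\<Sum>d | d dvd n. d ^ l)"

definition eisenstein_coeff :: "nat \<Rightarrow> nat \<Rightarrow> real" where
  "eisenstein_coeff k n =
     (if n = 0 then 1 else - (2 * real k / bernoulli k) * real (divisor_sum (k - 1) n))"

definition eisenstein_fps :: "nat \<Rightarrow> real fps" where
  "eisenstein_fps k = Abs_fps (eisenstein_coeff k)"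

definition eisenstein_q :: "nat \<Rightarrow> complex \<Rightarrow> complex" where
  "eisenstein_q k q = (\<Sum>n. of_real (eisenstein_coeff k n) * q ^ n)"

definition eisenstein :: "nat \<Rightarrow> complex \<Rightarrow> complex" where
  "eisenstein k z = eisenstein_q k (exp (2 * of_real pi * \<i> * z))"

text \<open>Since the constant term of the series is $1$, its multiplicative inverse as a formal power
  series is the power series expansion of the reciprocal around $q=0$.\<close>

definition recip_coeff :: "nat \<Rightarrow> nat \<Rightarrow> real" where
  "recip_coeff k n = fps_nth (inverse (eisenstein_fps k)) n"

definition std_fund_domain :: "complex set" where
  "std_fund_domain =
     {z. Im z > 0 \<and> norm z \<ge> 1 \<and> 0 \<le> Re z \<and> Re z \<le> 1 / 2} \<union>
     {z. Im z > 0 \<and> norm z > 1 \<and> - (1 / 2) < Re z \<and> Re z < 0}"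

definition is_highest_zero :: "nat \<Rightarrow> complex \<Rightarrow> bool" where
  "is_highest_zero k z \<longleftrightarrow>
     z \<in> std_fund_domain \<and> eisenstein k z = 0 \<and>
     (\<forall>w\<in>std_fund_domain. eisenstein k w = 0 \<longrightarrow> Im w \<le> Im z)"

definition highest_zero :: "nat \<Rightarrow> complex" where
  "highest_zero k = (THE z. is_highest_zero k z)"

definition num_sign_changes :: "real list \<Rightarrow> nat" where
  "num_sign_changes xs =
     (let ys = filter (\<lambda>x. x \<noteq> 0) xs
      in card {i. Suc i < length ys \<and> sgn (ys ! i) \<noteq> sgn (ys ! Suc i)})"

definition recip_sign_changes :: "nat \<Rightarrow> nat \<Rightarrow> nat" where
  "recip_sign_changes k n = num_sign_changes (map (recip_coeff k) [0..<Suc n])"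

definition recip_nonzero_count :: "nat \<Rightarrow> nat \<Rightarrow> nat" where
  "recip_nonzero_count k n = card {m. m < n \<and> recip_coeff k m \<noteq> 0}"

end

theory Submission
  imports Defs
begin

text \<open>
  Up to the factor \<open>\<zeta>(k)\<close>, the function \<open>E\<^sub>k(z) - 1 - z\<^sup>-\<^sup>k\<close> is the sum of \<open>(cz + d)\<^sup>-\<^sup>k\<close> over \<open>c \<ge> 1\<close>, \<open>d \<noteq> 0\<close>,
  which is small when \<open>z\<close> lies in the fundamental domain and high enough. Hence the zeros at the
  greatest height lie close to the points with \<open>z\<^sup>k = -1\<close>, and in the coordinate
  \<open>v = 1 + z\<^sup>-\<^sup>k\<close> the equation \<open>E\<^sub>k(z) = 0\<close> has the form \<open>v + R(v) = 0\<close> with a contraction \<open>R\<close>.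
  This shows that the highest zero in the right half of the strip is unique and simple. On the unit circle \<open>z\<^sup>k\<^sup>/\<^sup>2 E\<^sub>k(z)\<close>
  is real and changes sign there, so that zero has modulus one and real part \<open>x\<close> strictly between
  \<open>0\<close> and \<open>1/2\<close>.

  Therefore \<open>1/E\<^sub>k\<close> as a function of \<open>q\<close> has exactly two poles of minimal modulus \<open>r\<close>, which are
  simple and complex conjugate, and \<open>\<beta>\<^sub>k(n) r\<^sup>n = A cos(2\<pi>xn + \<phi>) + o(1)\<close> with \<open>A > 0\<close>. Since
  \<open>2\<pi>x < \<pi>\<close>, whenever the cosine is close to zero its two neighbours are bounded away from zero and
  have opposite signs. So the sign of such a coefficient, even if it vanishes, does not affect the
  number of sign changes, and two consecutive coefficients never vanish for large \<open>n\<close>.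
\<close>

subsection \<open>The Lipschitz formula and the values of zeta at even integers\<close>

text \<open>The coordinate \<open>v\<close> makes the estimates uniform in the weight:
  differentiating \<open>(cz + d)^-k\<close> costs a factor \<open>k\<close>, but
  \<open>dz/dv\<close> carries \<open>1/k\<close>, so the Lipschitz constant of \<open>R\<close> is
  a fixed multiple of a majorant of the tail, and the numbers found for \<open>k = 12\<close> serve
  for every larger weight. The inequality \<open>|G(v) - G(w)| \<ge> |v - w| / 2\<close> for
  \<open>G(v) = v + R(v)\<close> then yields uniqueness and simplicity together, without counting
  zeros by a contour integral. For \<open>k\<close> congruent to \<open>2\<close> modulo
  \<open>4\<close> the function vanishes at \<open>\<i>\<close>, where \<open>q\<close> is real;
  \<open>4 | k\<close> gives \<open>\<i>^k = 1\<close> and moves the first sign change on the circle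
  away from \<open>\<i>\<close>. Poles in \<open>q\<close> correspond to zeros in a whole strip,
  including points inside the unit disc; inversion carries those to the outside. The Eisenstein
  series is given by Bernoulli numbers and divisor sums, so its lattice form has to be established:
  the cotangent expansion, obtained from the reflection of Polygamma functions, supplies both the
  inner sums over \<open>d\<close> and Euler's value of \<open>\<zeta>(k)\<close>.\<close>

lemma pi_cot_eq_Digamma:
  fixes z :: complex
  assumes "z \<notin> \<int>"
  shows "(Digamma (1 - z) - Digamma z) * sin (of_real pi * z) = of_real pi * cos (of_real pi * z)"
proof -
  have z: "z \<notin> \<int>\<^sub>\<le>\<^sub>0" "1 - z \<notin> \<int>\<^sub>\<le>\<^sub>0"
  proof -
    show "z \<notin> \<int>\<^sub>\<le>\<^sub>0" using assms nonpos_Ints_Int by blast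
    show "1 - z \<notin> \<int>\<^sub>\<le>\<^sub>0" 
    proof
      assume "1 - z \<in> \<int>\<^sub>\<le>\<^sub>0"
      hence "1 - (1 - z) \<in> \<int>" by (intro Ints_diff Ints_1 nonpos_Ints_Int)
      thus False using assms by simp
    qed
  qed
  \<comment> \<open>The reflection product
    \<open>rGamma z * rGamma (1 - z) = sin (pi z) / pi\<close> is differentiated in two ways, once
    by the product rule and once as a sine.\<close>
  have "((\<lambda>z. rGamma z * rGamma (1 - z)) has_field_derivative
          rGamma z * rGamma (1 - z) * (Digamma (1 - z) - Digamma z)) (at z)"
    using z by (auto intro!: derivative_eq_intros simp: algebra_simps)
  moreover have "((\<lambda>z. rGamma z * rGamma (1 - z)) has_field_derivative cos (of_real pi * z)) (at z)"
    unfolding rGamma_reflection_complex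
    by (auto intro!: derivative_eq_intros)
  ultimately have "rGamma z * rGamma (1 - z) * (Digamma (1 - z) - Digamma z) = cos (of_real pi * z)"
    by (rule DERIV_unique)
  thus ?thesis unfolding rGamma_reflection_complex by (simp add: field_simps)
qed

text \<open>By uniqueness of derivatives on an open set, two chains of successive derivatives agree
  once their starting functions do. It transfers identities to explicit chains such as
  \<open>Polygamma n\<close>, and compares such a chain with \<open>deriv ^^ n\<close>.\<close>

lemma iterated_derivative_eq:
  fixes F G :: "nat \<Rightarrow> complex \<Rightarrow> complex"
  assumes "open S" and "\<And>z. z \<in> S \<Longrightarrow> F 0 z = G 0 z"
    and "\<And>n z. z \<in> S \<Longrightarrow> (F n has_field_derivative F (Suc n) z) (at z)"
    and "\<And>n z. z \<in> S \<Longrightarrow> (G n has_field_derivative G (Suc n) z) (at z)"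
    and "z \<in> S"
  shows "F n z = G n z"
  using \<open>z \<in> S\<close>
proof (induction n arbitrary: z)
  case (Suc n)
  have "(F n has_field_derivative G (Suc n) z) (at z)"
    by (rule has_field_derivative_transform_within_open[OF assms(4)[OF Suc.prems] \<open>open S\<close> Suc.prems])
       (simp add: Suc.IH)
  with assms(3)[OF Suc.prems] show ?case by (rule DERIV_unique)
qed (use assms in auto)

text \<open>The constant term is set to \<open>0\<close> separately because \<open>0 ^ 0 = 1\<close>
  would spoil the case \<open>n = 0\<close>.\<close>

definition power_fps :: "nat \<Rightarrow> complex fps" where
  "power_fps n = Abs_fps (\<lambda>m. if m = 0 then 0 else of_nat m ^ n)"

text \<open>The Euler operator \<open>q d/dq\<close> is, up to \<open>2 pi i\<close>, the derivative
  in \<open>z\<close>; thus these series form a chain parallel to the Polygamma functions.\<close>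

lemma fps_X_deriv_power_fps: "fps_X * fps_deriv (power_fps n) = power_fps (Suc n)"
  by (rule fps_ext) (auto simp: power_fps_def fps_X_mult_nth)

lemma fps_conv_radius_power_fps: "fps_conv_radius (power_fps n) \<ge> 1"
proof (induction n)
  case 0
  have "summable (\<lambda>m. fps_nth (power_fps 0) m * complex_of_real r ^ m)" if "0 < r" "ereal r < 1" for r
    by (rule summable_comparison_test'[OF summable_geometric[of r], of 0])
       (use that in \<open>auto simp: power_fps_def norm_power norm_mult\<close>)
  thus ?case unfolding fps_conv_radius_def by (rule conv_radius_geI_ex')
next
  case (Suc n)
  have "1 \<le> min (fps_conv_radius (fps_X :: complex fps)) (fps_conv_radius (fps_deriv (power_fps n)))"
    using Suc fps_conv_radius_deriv[of "power_fps n"] by (auto intro: order.trans)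
  also have "\<dots> \<le> fps_conv_radius (power_fps (Suc n))"
    unfolding fps_X_deriv_power_fps [symmetric] by (rule fps_conv_radius_mult)
  finally show ?case .
qed

lemma less_fps_conv_radius_power_fps:
  assumes "r < 1"
  shows "ereal r < fps_conv_radius (power_fps n)"
proof -
  have "ereal r < 1" using assms by simp
  also have "1 \<le> fps_conv_radius (power_fps n)" by (rule fps_conv_radius_power_fps)
  finally show ?thesis .
qed

definition nome :: "complex \<Rightarrow> complex" where
  "nome z = exp (2 * of_real pi * \<i> * z)"

lemma norm_nome: "norm (nome z) = exp (-(2 * pi * Im z))"
  by (simp add: nome_def)

lemma norm_nome_less_1: "Im z > 0 \<Longrightarrow> norm (nome z) < 1"
  by (simp add: norm_nome)

lemma nome_has_field_derivative [derivative_intros]: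
  "(nome has_field_derivative 2 * of_real pi * \<i> * nome z) (at z within A)"
  unfolding nome_def by (auto intro!: derivative_eq_intros)

lemma eval_power_fps_nome_has_field_derivative:
  assumes "Im z > 0"
  shows "((\<lambda>z. eval_fps (power_fps n) (nome z)) has_field_derivative
            2 * of_real pi * \<i> * eval_fps (power_fps (Suc n)) (nome z)) (at z)"
proof -
  have r: "ereal (norm (nome z)) < fps_conv_radius (power_fps n)"
    by (intro less_fps_conv_radius_power_fps norm_nome_less_1 assms)
  have "eval_fps (power_fps (Suc n)) (nome z) = nome z * eval_fps (fps_deriv (power_fps n)) (nome z)"
    unfolding fps_X_deriv_power_fps [symmetric]
    using r fps_conv_radius_deriv[of "power_fps n"] by (subst eval_fps_mult) (auto intro: less_le_trans)
  thus ?thesis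
    using DERIV_chain2[OF has_field_derivative_eval_fps[OF r] nome_has_field_derivative[of z UNIV]]
    by (simp add: mult_ac)
qed

lemma eval_power_fps_0: 
  assumes "norm q < 1"
  shows "eval_fps (power_fps 0) q = q / (1 - q)"
proof -
  have "(\<lambda>n. q * q ^ n) sums (q * (1 / (1 - q)))"
    by (intro sums_mult geometric_sums assms)
  hence "(\<lambda>n. fps_nth (power_fps 0) (Suc n) * q ^ Suc n) sums (q / (1 - q))"
    by (simp add: power_fps_def)
  hence "(\<lambda>n. fps_nth (power_fps 0) n * q ^ n) sums (q / (1 - q))"
    by (subst (asm) sums_Suc_iff) (simp add: power_fps_def)
  thus ?thesis unfolding eval_fps_def by (simp add: sums_iff)
qed

lemma not_Ints_if_Im_pos: "Im z > 0 \<Longrightarrow> z \<notin> \<int>"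
  by (auto elim!: Ints_cases)

text \<open>The cotangent in exponential form, with \<open>u\<close> a square root of
  \<open>nome z\<close>. It is free of division and holds off the integers rather than only on the
  upper half plane, because it is also applied in a punctured disc around \<open>0\<close>.\<close>

lemma Digamma_diff_nome_mult:
  assumes "z \<notin> \<int>"
  shows "(Digamma (1 - z) - Digamma z) * (nome z - 1) = of_real pi * \<i> * (nome z + 1)"
proof -
  define u where "u = exp (\<i> * of_real pi * z)"
  have u: "u \<noteq> 0" and q: "nome z = u ^ 2"
    by (auto simp: u_def nome_def exp_double [symmetric] mult_ac)
  have s: "2 * \<i> * u * sin (of_real pi * z) = u ^ 2 - 1" 
    and c: "2 * u * cos (of_real pi * z) = u ^ 2 + 1"
    unfolding sin_exp_eq cos_exp_eq u_def 
    by (simp_all add: exp_minus field_simps power2_eq_square)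
  define D where "D = Digamma (1 - z) - Digamma z"
  have D: "D * sin (of_real pi * z) = of_real pi * cos (of_real pi * z)"
    unfolding D_def by (rule pi_cot_eq_Digamma) (use assms not_Ints_if_Im_pos in auto)
  have "D * (u ^ 2 - 1) = 2 * \<i> * u * (D * sin (of_real pi * z))"
    by (simp only: s [symmetric] mult_ac)
  also have "\<dots> = of_real pi * \<i> * (2 * u * cos (of_real pi * z))"
    unfolding D by (simp only: mult_ac)
  finally show ?thesis unfolding c by (simp add: q D_def)
qed

lemma Digamma_diff_nome:
  assumes "Im z > 0"
  shows "Digamma (1 - z) - Digamma z =
           - (of_real pi * \<i>) - 2 * of_real pi * \<i> * eval_fps (power_fps 0) (nome z)"
proof -
  have q: "norm (nome z) < 1" by (rule norm_nome_less_1) fact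
  hence ne: "1 - nome z \<noteq> 0" by auto
  have "(Digamma (1 - z) - Digamma z) * (1 - nome z) = - (of_real pi * \<i> * (nome z + 1))"
    using Digamma_diff_nome_mult[OF not_Ints_if_Im_pos[OF assms]] by (simp add: algebra_simps)
  hence "Digamma (1 - z) - Digamma z = - (of_real pi * \<i> * (nome z + 1)) / (1 - nome z)"
    using ne by (simp add: field_simps)
  also have "\<dots> = - (of_real pi * \<i>) - 2 * of_real pi * \<i> * (nome z / (1 - nome z))"
    using ne by (simp add: field_simps)
  finally show ?thesis
    using q by (simp add: eval_power_fps_0)
qed

text \<open>The \<open>n\<close>-th derivative of the cotangent expansion: the constant
  \<open>- pi i\<close> disappears, and each derivative contributes a sign to the term in
  \<open>1 - z\<close>.\<close>

lemma Polygamma_reflection_nome: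
  assumes "Im z > 0" and "n > 0"
  shows "(-1) ^ n * Polygamma n (1 - z) - Polygamma n z =
           - ((2 * of_real pi * \<i>) ^ Suc n * eval_fps (power_fps n) (nome z))"
proof -
  define F where "F = (\<lambda>n z. (-1) ^ n * Polygamma n (1 - z) - Polygamma n z :: complex)"
  define G where "G = (\<lambda>n z. (if n = 0 then - (of_real pi * \<i>) else 0) 
                       - (2 * of_real pi * \<i>) ^ Suc n * eval_fps (power_fps n) (nome z))"
  have "F n z = G n z"
  proof (rule iterated_derivative_eq[where S = "{z. Im z > 0}" and F = F and G = G])
    show "open {z. Im z > 0}" by (rule open_halfspace_Im_gt)
    show "F 0 z = G 0 z" if "z \<in> {z. Im z > 0}" for z
      using Digamma_diff_nome that by (simp add: F_def G_def)
  next
    fix n z assume z: "z \<in> {z. Im z > 0}"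
    have "z \<notin> \<int>\<^sub>\<le>\<^sub>0" "1 - z \<notin> \<int>\<^sub>\<le>\<^sub>0"
      using z by (auto elim!: nonpos_Ints_cases simp: complex_eq_iff)
    thus "(F n has_field_derivative F (Suc n) z) (at z)"
      unfolding F_def by (auto intro!: derivative_eq_intros)
    have "((\<lambda>z. (if n = 0 then - (of_real pi * \<i>) else 0) 
              - (2 * of_real pi * \<i>) ^ Suc n * eval_fps (power_fps n) (nome z)) has_field_derivative
            0 - (2 * of_real pi * \<i>) ^ Suc n * (2 * of_real pi * \<i> * eval_fps (power_fps (Suc n)) (nome z))) (at z)"
      by (intro DERIV_diff DERIV_const DERIV_cmult eval_power_fps_nome_has_field_derivative) (use z in auto)
    thus "(G n has_field_derivative G (Suc n) z) (at z)"
      by (simp add: G_def mult_ac)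
  qed (use assms in auto)
  thus ?thesis using assms by (simp add: F_def G_def)
qed

text \<open>The Polygamma series at \<open>z\<close> runs over \<open>z + d\<close> with
  \<open>d \<ge> 0\<close>, the one at \<open>1 - z\<close> over
  \<open>1 - z + d = -(z - (d + 1))\<close>. As \<open>k\<close> is even the sign is lost, and
  together they cover all integer shifts; the shift \<open>0\<close> is the term
  \<open>1 / z ^ k\<close> on the right.\<close>

lemma Lipschitz_formula:
  assumes "Im z > 0" and "even k" and "k \<ge> 2"
  shows "(\<lambda>d. 1 / (z + of_nat (Suc d)) ^ k + 1 / (z - of_nat (Suc d)) ^ k) sums
           ((2 * of_real pi * \<i>) ^ k / fact (k - 1) * eval_fps (power_fps (k - 1)) (nome z) - 1 / z ^ k)"
proof -
  define n where "n = k - 1"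
  have k: "k = Suc n" and n: "n > 0" "odd n" using assms by (auto simp: n_def)
  have z: "z \<noteq> 0" "1 - z \<noteq> 0" using assms(1) by auto
  have "(\<lambda>d. inverse ((z + of_nat d) ^ k)) sums (Polygamma n z / fact n)"
    using Polygamma_LIMSEQ[OF z(1) n(1)] n by (simp add: k)
  hence 1: "(\<lambda>d. inverse ((z + of_nat (Suc d)) ^ k)) sums (Polygamma n z / fact n - 1 / z ^ k)"
    by (subst sums_Suc_iff) (simp add: field_simps)
  have "(\<lambda>d. inverse ((1 - z + of_nat d) ^ k)) sums (Polygamma n (1 - z) / fact n)"
    using Polygamma_LIMSEQ[OF z(2) n(1)] n by (simp add: k)
  also have "(\<lambda>d. inverse ((1 - z + of_nat d) ^ k)) = (\<lambda>d. inverse ((z - of_nat (Suc d)) ^ k))"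
    using power_minus_even[OF assms(2)] by (metis (no_types, opaque_lifting) add.commute diff_add_eq minus_diff_eq of_nat_Suc)
  finally have "(\<lambda>d. inverse ((z + of_nat (Suc d)) ^ k) + inverse ((z - of_nat (Suc d)) ^ k)) sums
     ((Polygamma n z / fact n - 1 / z ^ k) + Polygamma n (1 - z) / fact n)"
    by (intro sums_add 1)
  moreover have "Polygamma n z + Polygamma n (1 - z) = (2 * of_real pi * \<i>) ^ k * eval_fps (power_fps n) (nome z)"
    using Polygamma_reflection_nome[OF assms(1) n(1)] n(2) by (simp add: k algebra_simps)
  ultimately show ?thesis
    unfolding n_def [symmetric] by (simp add: inverse_eq_divide add_divide_distrib [symmetric] algebra_simps)
qed

section \<open>Euler's evaluation of the zeta function at even integers\<close>

definition zeta_nat :: "nat \<Rightarrow> real" where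
  "zeta_nat k = (\<Sum>n. 1 / real (Suc n) ^ k)"

lemma zeta_nat_sums: "k \<ge> 2 \<Longrightarrow> (\<lambda>n. 1 / real (Suc n) ^ k) sums zeta_nat k"
  unfolding zeta_nat_def
  using inverse_power_summable[of k, where ?'a = real]
  by (subst (asm) summable_Suc_iff [symmetric]) (auto intro!: summable_sums simp: field_simps)

lemma zeta_nat_ge_1: "k \<ge> 2 \<Longrightarrow> zeta_nat k \<ge> 1"
  using sum_le_suminf[of "\<lambda>n. 1 / real (Suc n) ^ k" "{0}"] zeta_nat_sums[of k]
  by (simp add: zeta_nat_def sums_iff)

lemma Polygamma_1: 
  assumes "n > 0"
  shows "Polygamma n 1 = (-1) ^ Suc n * fact n * complex_of_real (zeta_nat (Suc n))"
proof -
  have "(\<lambda>d. inverse ((1 + of_nat d) ^ Suc n) :: complex) sums ((- 1) ^ Suc n * Polygamma n 1 / fact n)"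
    by (rule Polygamma_LIMSEQ) (use assms in auto)
  moreover have "(\<lambda>d. of_real (1 / real (Suc d) ^ Suc n) :: complex) sums of_real (zeta_nat (Suc n))"
    by (intro sums_of_real zeta_nat_sums) (use assms in auto)
  ultimately have "(- 1) ^ Suc n * Polygamma n 1 / fact n = complex_of_real (zeta_nat (Suc n))"
    by (intro sums_unique2[of "\<lambda>d. inverse ((1 + of_nat d) ^ Suc n)"]) (simp_all add: field_simps)
  hence "(-1) ^ Suc n * ((- 1) ^ Suc n * Polygamma n 1) = (-1) ^ Suc n * fact n * complex_of_real (zeta_nat (Suc n))"
    by (simp add: field_simps)
  thus ?thesis by (simp only: mult.assoc [symmetric] power_mult_distrib [symmetric]) simp
qed

lemma one_pm_ball_notin_nonpos_Ints:
  fixes z :: complex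
  assumes "norm z < 1"
  shows "1 + z \<notin> \<int>\<^sub>\<le>\<^sub>0" "1 - z \<notin> \<int>\<^sub>\<le>\<^sub>0"
proof -
  have "\<bar>Re z\<bar> < 1" using abs_Re_le_cmod[of z] assms by linarith
  thus "1 + z \<notin> \<int>\<^sub>\<le>\<^sub>0" "1 - z \<notin> \<int>\<^sub>\<le>\<^sub>0"
    by (auto elim!: nonpos_Ints_cases simp: complex_eq_iff)
qed

text \<open>The generating function with \<open>x\<close> replaced by \<open>a x\<close>, cleared of
  its denominator. Equal subdegrees make the division in \<open>bernoulli\<close> exact; the
  resulting real recursion is multiplied by \<open>a ^ n\<close>.\<close>

lemma fps_exp_minus_1_times_bernoulli:
  fixes a :: complex
  shows "(fps_exp a - 1) * Abs_fps (\<lambda>n. of_real (bernoulli n / fact n) * a ^ n) = fps_const a * fps_X"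
proof -
  define b where "b = (fps_X / (fps_exp 1 - 1) :: real fps)"
  have nz: "fps_exp 1 - 1 \<noteq> (0 :: real fps)"
    by (metis fps_exp_0 fps_exp_eq_iff eq_iff_diff_eq_0 zero_neq_one)
  have "subdegree (fps_exp 1 - 1 :: real fps) = 1"
    by (rule subdegreeI) auto
  with nz have "(fps_exp 1 - 1 :: real fps) dvd fps_X"
    by (subst fps_dvd_iff) auto
  hence b_eq: "(fps_exp 1 - 1) * b = fps_X" unfolding b_def by simp
  have b: "(\<Sum>i=0..n. (if i = 0 then 0 else 1 / fact i) * fps_nth b (n - i)) = (if n = 1 then 1 else 0)" for n
  proof -
    have "(\<Sum>i=0..n. (if i = 0 then 0 else 1 / fact i) * fps_nth b (n - i)) = fps_nth ((fps_exp 1 - 1) * b) n"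
      unfolding fps_mult_nth by (intro sum.cong) auto
    thus ?thesis by (simp add: b_eq)
  qed
  have bb: "bernoulli n / fact n = fps_nth b n" for n
    by (simp add: bernoulli_def b_def)
  show ?thesis unfolding bb
  proof (rule fps_ext)
    fix n :: nat
    have "fps_nth ((fps_exp a - 1) * Abs_fps (\<lambda>n. of_real (fps_nth b n) * a ^ n)) n =
            (\<Sum>i=0..n. (if i = 0 then 0 else a ^ i / fact i) * (of_real (fps_nth b (n - i)) * a ^ (n - i)))"
      unfolding fps_mult_nth by (intro sum.cong) auto
    also have "\<dots> = (\<Sum>i=0..n. a ^ n * of_real ((if i = 0 then 0 else 1 / fact i) * fps_nth b (n - i)))"
      by (intro sum.cong) (auto simp: power_add [symmetric])
    also have "\<dots> = a ^ n * of_real (if n = 1 then 1 else 0)"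
      unfolding b [symmetric] by (simp only: sum_distrib_left of_real_sum)
    finally show "fps_nth ((fps_exp a - 1) * Abs_fps (\<lambda>n. of_real (fps_nth b n) * a ^ n)) n =
            fps_nth (fps_const a * fps_X) n" by (cases "n = 1") auto
  qed
qed

text \<open>\<open>F 0\<close> is \<open>pi cot (pi z) - 1/z\<close>, regular at \<open>0\<close>.
  With \<open>a = 2 pi i\<close> one has
  \<open>z * F 0 z + 1 - a z / 2 = a z / (exp (a z) - 1)\<close>; the Taylor coefficients are zeta
  values on the left, through \<open>Polygamma n 1\<close>, and Bernoulli numbers on the
  right.\<close>

lemma zeta_nat_even:
  assumes "even k" and "k \<ge> 2"
  shows "2 * complex_of_real (zeta_nat k) = - ((2 * of_real pi * \<i>) ^ k * of_real (bernoulli k / fact k))"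
proof -
  define F where "F = (\<lambda>n z. (-1) ^ n * Polygamma n (1 - z) - Polygamma n (1 + z) :: complex)"
  have F_deriv: "(F n has_field_derivative F (Suc n) z) (at z)" if "z \<in> ball 0 1" for n z
    using one_pm_ball_notin_nonpos_Ints[of z] that unfolding F_def 
    by (auto intro!: derivative_eq_intros)
  have holo: "F 0 holomorphic_on ball 0 1"
    using F_deriv[of _ 0] by (fastforce simp: holomorphic_on_open)
  have Fn: "F n 0 = (deriv ^^ n) (F 0) 0" for n
  proof (rule iterated_derivative_eq[where S = "ball 0 1" and F = F and G = "\<lambda>n. (deriv ^^ n) (F 0)"])
    fix n and z :: complex assume "z \<in> ball 0 1"
    thus "((deriv ^^ n) (F 0) has_field_derivative (deriv ^^ Suc n) (F 0) z) (at z)"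
      using holomorphic_derivI[OF holomorphic_higher_deriv[OF holo]] by simp
  qed (use F_deriv in auto)
  define f where "f = fps_expansion (F 0) 0"
  have f: "F 0 has_fps_expansion f"
    unfolding f_def using holo by (intro has_fps_expansion_fps_expansion[of "ball 0 1"]) auto
  define a where "a = 2 * complex_of_real pi * \<i>"
  have "(\<lambda>z. (exp (a * z) - 1) * (z * F 0 z + 1 - a / 2 * z)) has_fps_expansion
          (fps_exp a - 1) * (fps_X * f + 1 - fps_const (a / 2) * fps_X)"
    by (intro fps_expansion_intros f)
  moreover have "(\<lambda>z. (exp (a * z) - 1) * (z * F 0 z + 1 - a / 2 * z)) has_fps_expansion fps_const a * fps_X"
  proof -
    have "(\<lambda>z. a * z) has_fps_expansion fps_const a * fps_X"
      by (intro fps_expansion_intros)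
    moreover have "(exp (a * z) - 1) * (z * F 0 z + 1 - a / 2 * z) = a * z" if "z \<in> ball 0 1" for z
    proof (cases "z = 0")
      case False
      have z: "z \<notin> \<int>"
        using that False by (auto elim!: Ints_cases)
      have e: "exp (a * z) = nome z" by (simp add: nome_def a_def)
      have F0: "F 0 z = Digamma (1 - z) - Digamma z - 1 / z"
        using Polygamma_plus1[of z 0] False by (simp add: F_def add.commute)
      have eq: "z * F 0 z + 1 - a / 2 * z = z * (Digamma (1 - z) - Digamma z - a / 2)"
        unfolding F0 using False by (simp add: algebra_simps)
      have "(exp (a * z) - 1) * (z * F 0 z + 1 - a / 2 * z) = 
               z * ((Digamma (1 - z) - Digamma z) * (nome z - 1) - a / 2 * (nome z - 1))"
        unfolding e eq by (simp add: algebra_simps)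
      also have "\<dots> = a * z"
        unfolding Digamma_diff_nome_mult[OF z] by (simp add: a_def algebra_simps)
      finally show ?thesis .
    qed auto
    hence ev: "eventually (\<lambda>z. (exp (a * z) - 1) * (z * F 0 z + 1 - a / 2 * z) = a * z) (nhds 0)"
      by (intro eventually_nhds_in_open[THEN eventually_mono, of "ball 0 1"]) auto
    ultimately show ?thesis
      using has_fps_expansion_cong[OF ev refl[of "fps_const a * fps_X"]] by (rule_tac iffD2) simp_all
  qed
  ultimately have "(fps_exp a - 1) * (fps_X * f + 1 - fps_const (a / 2) * fps_X) = fps_const a * fps_X"
    using fps_expansion_unique_complex by blast
  also have "\<dots> = (fps_exp a - 1) * Abs_fps (\<lambda>n. of_real (bernoulli n / fact n) * a ^ n)"
    by (rule fps_exp_minus_1_times_bernoulli [symmetric])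
  finally have "fps_X * f + 1 - fps_const (a / 2) * fps_X = Abs_fps (\<lambda>n. of_real (bernoulli n / fact n) * a ^ n)"
  proof (subst (asm) mult_cancel_left, elim disjE)
    assume "fps_exp a - 1 = 0"
    hence "fps_nth (fps_exp a - 1) 1 = 0" by simp
    thus ?thesis by (simp add: a_def)
  qed
  hence "fps_nth (fps_X * f + 1 - fps_const (a / 2) * fps_X) k = of_real (bernoulli k / fact k) * a ^ k"
    by simp
  \<comment> \<open>The correction terms \<open>1\<close> and \<open>a/2 * X\<close> live in degrees
    \<open>0\<close> and \<open>1\<close>, below \<open>k\<close>; the factor \<open>fps_X\<close>
    shifts the index by one.\<close>
  hence "fps_nth f (k - 1) = of_real (bernoulli k / fact k) * a ^ k"
    using assms by (cases k; cases "k - 1") auto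
  moreover have "fps_nth f (k - 1) = F (k - 1) 0 / fact (k - 1)"
    unfolding Fn by (rule fps_nth_fps_expansion[OF f])
  moreover have "F (k - 1) 0 = - 2 * fact (k - 1) * complex_of_real (zeta_nat k)"
    using assms by (simp add: F_def Polygamma_1)
  moreover define X where "X = of_real (bernoulli k / fact k) * a ^ k"
  ultimately have "X * fact (k - 1) = (- 2 * complex_of_real (zeta_nat k)) * fact (k - 1)"
    by simp
  hence "X = - 2 * complex_of_real (zeta_nat k)"
    by (subst (asm) mult_cancel_right) simp
  hence "2 * complex_of_real (zeta_nat k) = - X" by simp
  hence "2 * complex_of_real (zeta_nat k) = - (a ^ k * of_real (bernoulli k / fact k))"
    unfolding X_def by (simp only: mult.commute)
  thus ?thesis by (simp add: a_def)
qed

subsection \<open>Lattice sums and modularity\<close>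

lemma has_sum_product_nonneg:
  fixes f :: "'a \<Rightarrow> real" and g :: "'b \<Rightarrow> real"
  assumes f: "(f has_sum F) A" and g: "(g has_sum G) B"
    and "\<And>x. x \<in> A \<Longrightarrow> f x \<ge> 0" and "\<And>y. y \<in> B \<Longrightarrow> g y \<ge> 0"
  shows "((\<lambda>(x, y). f x * g y) has_sum (F * G)) (A \<times> B)"
proof -
  have "(\<lambda>(x, y). f x * g y) summable_on (A \<times> B)"
    using has_sum_imp_summable[OF has_sum_cmult_left[OF f, of G]] has_sum_cmult_right[OF g] assms(3,4)
    by (intro summable_on_SigmaI[where g = "\<lambda>x. f x * G"]) auto
  thus ?thesis
    using has_sum_cmult_left[OF f, of G] has_sum_cmult_right[OF g]
    by (intro has_sum_SigmaI[where g = "\<lambda>x. f x * G"]) auto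
qed

lemma has_sum_inverse_power_product:
  assumes "m \<ge> 2"
  shows "((\<lambda>(c, d). 1 / (real (Suc c) * real (Suc d)) ^ m) has_sum (zeta_nat m ^ 2)) UNIV"
proof -
  have "((\<lambda>n. 1 / real (Suc n) ^ m) has_sum zeta_nat m) UNIV"
    by (intro sums_nonneg_imp_has_sum zeta_nat_sums assms) auto
  from has_sum_product_nonneg[OF this this] show ?thesis
    by (simp add: power2_eq_square power_mult_distrib)
qed

text \<open>The imaginary part of \<open>w = c z + d\<close> isolates \<open>c\<close>, that of
  \<open>w * cnj z\<close> isolates \<open>d\<close>. The product form makes the lattice sum
  comparable with a product of two zeta series of exponent \<open>k/2\<close>, convergent for
  \<open>k \<ge> 4\<close>.\<close>

lemma norm_linear_form_ge:
  assumes "Im z > 0"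
  shows "norm (of_real c * z + of_real d) ^ 2 \<ge> \<bar>c * d\<bar> * ((Im z) ^ 2 / norm z)"
proof -
  have z: "norm z > 0" using assms by auto
  let ?w = "of_real c * z + of_real d"
  have 1: "\<bar>c\<bar> * Im z \<le> norm ?w"
    using abs_Im_le_cmod[of ?w] assms by (simp add: abs_mult)
  have "\<bar>d\<bar> * Im z \<le> norm (?w * cnj z)"
    using abs_Im_le_cmod[of "?w * cnj z"] assms by (simp add: abs_mult algebra_simps)
  hence 2: "\<bar>d\<bar> * Im z \<le> norm ?w * norm z"
    by (simp add: norm_mult)
  have "(\<bar>c\<bar> * Im z) * (\<bar>d\<bar> * Im z) \<le> norm ?w * (norm ?w * norm z)"
    by (intro mult_mono 1 2) (use assms in auto)
  thus ?thesis using z by (simp add: field_simps power2_eq_square abs_mult)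
qed

text \<open>One vector from each pair \<open>\<plusminus>(c, d)\<close> with both entries nonzero.
  The vectors on the axes are left out, since after division by \<open>\<zeta>(k)\<close> they are
  the terms \<open>1\<close> and \<open>1 / z ^ k\<close>. Pairing \<open>d\<close> with
  \<open>-d\<close> fits the Lipschitz formula and leaves an index set symmetric in \<open>c\<close>
  and \<open>d\<close>.\<close>

definition lattice_term :: "nat \<Rightarrow> complex \<Rightarrow> nat \<times> nat \<Rightarrow> complex" where
  "lattice_term k z = (\<lambda>(c, d). 1 / (of_nat (Suc c) * z + of_nat (Suc d)) ^ k +
                                1 / (of_nat (Suc c) * z - of_nat (Suc d)) ^ k)"

definition lattice_tail :: "nat \<Rightarrow> complex \<Rightarrow> complex" where
  "lattice_tail k z = infsum (lattice_term k z) UNIV"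

lemma summable_on_linear_form_norm:
  fixes s :: real
  assumes "Im z > 0" and "m \<ge> 2" and "\<bar>s\<bar> = 1"
  shows "(\<lambda>(c, d). 1 / norm (of_nat (Suc c) * z + of_real (s * real (Suc d))) ^ (2 * m)) summable_on UNIV"
proof -
  define \<kappa> where "\<kappa> = (Im z) ^ 2 / norm z"
  have z: "z \<noteq> 0" using assms(1) by auto
  have \<kappa>: "\<kappa> > 0" using assms z by (simp add: \<kappa>_def)
  have "(\<lambda>(c, d). (1 / \<kappa> ^ m) * (1 / (real (Suc c) * real (Suc d)) ^ m)) summable_on UNIV"
    using has_sum_imp_summable[OF has_sum_inverse_power_product[OF assms(2)]]
    unfolding case_prod_unfold by (intro summable_on_cmult_right)
  thus ?thesis
  proof (rule summable_on_comparison_test)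
    fix x :: "nat \<times> nat"
    obtain c d where x: "x = (c, d)" by (cases x)
    have "(\<kappa> * (real (Suc c) * real (Suc d))) ^ m \<le> (norm (of_nat (Suc c) * z + of_real (s * real (Suc d))) ^ 2) ^ m"
      using norm_linear_form_ge[OF assms(1), of "real (Suc c)" "s * real (Suc d)"] \<kappa> assms(3)
      by (intro power_mono) (simp_all add: \<kappa>_def abs_mult mult_ac)
    moreover have "(\<kappa> * (real (Suc c) * real (Suc d))) ^ m > 0"
      using \<kappa> by (intro zero_less_power mult_pos_pos) auto
    ultimately have "1 / norm (of_nat (Suc c) * z + of_real (s * real (Suc d))) ^ (2 * m) 
        \<le> 1 / (\<kappa> * (real (Suc c) * real (Suc d))) ^ m"
      unfolding power_mult by (intro divide_left_mono mult_pos_pos) auto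
    thus "(case x of (c, d) \<Rightarrow> 1 / norm (of_nat (Suc c) * z + of_real (s * real (Suc d))) ^ (2 * m))
      \<le> (case x of (c, d) \<Rightarrow> (1 / \<kappa> ^ m) * (1 / (real (Suc c) * real (Suc d)) ^ m))"
      by (simp add: x power_mult_distrib)
  qed auto
qed

definition lattice_norm_term :: "nat \<Rightarrow> complex \<Rightarrow> nat \<times> nat \<Rightarrow> real" where
  "lattice_norm_term k z = (\<lambda>(c, d). 1 / norm (of_nat (Suc c) * z + of_nat (Suc d)) ^ k +
                                1 / norm (of_nat (Suc c) * z - of_nat (Suc d)) ^ k)"

lemma norm_lattice_term_le: "norm (lattice_term k z x) \<le> lattice_norm_term k z x"
  by (cases x) (auto simp: lattice_term_def lattice_norm_term_def norm_divide norm_power 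
                     intro!: order.trans[OF norm_triangle_ineq])

lemma lattice_norm_term_summable:
  assumes "Im z > 0" and "even k" and "k \<ge> 4"
  shows "lattice_norm_term k z summable_on UNIV"
proof -
  obtain m where m: "k = 2 * m" "m \<ge> 2" using assms by auto
  from summable_on_add[OF summable_on_linear_form_norm[OF assms(1) m(2), of 1] 
      summable_on_linear_form_norm[OF assms(1) m(2), of "-1"]]
  show ?thesis
    unfolding lattice_norm_term_def m(1) by (simp add: case_prod_unfold algebra_simps)
qed

lemma lattice_term_abs_summable:
  assumes "Im z > 0" and "even k" and "k \<ge> 4"
  shows "(\<lambda>x. norm (lattice_term k z x)) summable_on UNIV"
  by (rule summable_on_comparison_test[OF lattice_norm_term_summable[OF assms]])
     (auto intro: norm_lattice_term_le)

lemma lattice_term_summable: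
  assumes "Im z > 0" and "even k" and "k \<ge> 4"
  shows "lattice_term k z summable_on UNIV"
  using lattice_term_abs_summable[OF assms] by (rule abs_summable_summable)

text \<open>Up to a factor \<open>1/z\<close>, inversion turns the vector \<open>(c, d)\<close> into
  \<open>(d, -c)\<close>; it swaps the two summation indices, and the even exponent absorbs the
  sign.\<close>

lemma lattice_tail_inversion:
  assumes "z \<noteq> 0" and "even k"
  shows "lattice_tail k (- 1 / z) = z ^ k * lattice_tail k z"
proof -
  have "lattice_term k (- 1 / z) (c, d) = z ^ k * lattice_term k z (d, c)" for c d
  proof -
    have e1: "of_nat (Suc c) * (- 1 / z) + of_nat (Suc d) = (of_nat (Suc d) * z - of_nat (Suc c)) / z"
      and e2: "of_nat (Suc c) * (- 1 / z) - of_nat (Suc d) = - ((of_nat (Suc d) * z + of_nat (Suc c)) / z)"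
      using assms by (simp_all add: field_simps)
    show ?thesis
      unfolding lattice_term_def prod.case e1 e2 power_minus_even[OF assms(2)]
      by (simp add: power_divide algebra_simps)
  qed
  hence "lattice_term k (- 1 / z) = (\<lambda>x. z ^ k * (lattice_term k z \<circ> prod.swap) x)"
    by (auto simp: fun_eq_iff)
  hence "lattice_tail k (- 1 / z) = z ^ k * infsum (lattice_term k z \<circ> prod.swap) UNIV"
    unfolding lattice_tail_def by (simp only: infsum_cmult_right')
  also have "infsum (lattice_term k z \<circ> prod.swap) UNIV = infsum (lattice_term k z) (range prod.swap)"
    by (rule infsum_reindex [symmetric]) auto
  finally show ?thesis by (simp add: lattice_tail_def)
qed

section \<open>Divisor sums, Lambert series and the lattice form of the Eisenstein series\<close>

lemma divisor_sum_0 [simp]: "divisor_sum l 0 = 0"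
  by (simp add: divisor_sum_def)

lemma divisor_sum_le: "divisor_sum l n \<le> n ^ Suc l"
proof (cases "n = 0")
  case False
  have "divisor_sum l n \<le> (\<Sum>d | d dvd n. n ^ l)"
    unfolding divisor_sum_def by (intro sum_mono power_mono) (use False in \<open>auto dest: dvd_imp_le\<close>)
  also have "\<dots> = card {d. d dvd n} * n ^ l" by simp
  also have "card {d. d dvd n} \<le> card {1..n}"
    by (rule card_mono) (use False in \<open>auto dest: dvd_imp_le intro!: Suc_leI Nat.gr0I\<close>)
  finally show ?thesis by simp
qed simp

definition eisenstein_cfps :: "nat \<Rightarrow> complex fps" where
  "eisenstein_cfps k = Abs_fps (\<lambda>n. of_real (eisenstein_coeff k n))"

lemma fps_conv_radius_eisenstein: "fps_conv_radius (eisenstein_cfps k) \<ge> 1"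
  unfolding fps_conv_radius_def
proof (rule conv_radius_geI_ex')
  fix r :: real assume r: "0 < r" "ereal r < 1"
  define C where "C = \<bar>2 * real k / bernoulli k\<bar>"
  have "ereal (norm (complex_of_real r)) < fps_conv_radius (power_fps (Suc (k - 1)))"
    using r by (intro less_fps_conv_radius_power_fps) simp
  from norm_summable_fps[OF this] 
  have sm: "summable (\<lambda>n. C * norm (fps_nth (power_fps (Suc (k - 1))) n * of_real r ^ n))"
    by (rule summable_mult)
  show "summable (\<lambda>n. fps_nth (eisenstein_cfps k) n * of_real r ^ n)"
  proof (rule summable_comparison_test'[OF sm, of 1])
    fix n :: nat assume n: "n \<ge> 1"
    have le: "real (divisor_sum (k - 1) n) \<le> real n ^ Suc (k - 1)"
      using divisor_sum_le[of "k - 1" n] by (metis of_nat_le_iff of_nat_power)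
    have "fps_nth (eisenstein_cfps k) n * complex_of_real r ^ n = of_real (eisenstein_coeff k n * r ^ n)"
      by (simp add: eisenstein_cfps_def)
    hence "norm (fps_nth (eisenstein_cfps k) n * complex_of_real r ^ n) = C * real (divisor_sum (k - 1) n) * r ^ n"
      using r n by (simp only: norm_of_real) (simp add: eisenstein_coeff_def C_def abs_mult)
    also have "\<dots> \<le> C * real n ^ Suc (k - 1) * r ^ n"
      using le r by (intro mult_right_mono mult_left_mono) (auto simp: C_def)
    also have "\<dots> = C * norm (fps_nth (power_fps (Suc (k - 1))) n * of_real r ^ n)"
      using r n by (simp add: power_fps_def norm_mult norm_power mult_ac)
    finally show "norm (fps_nth (eisenstein_cfps k) n * complex_of_real r ^ n)
       \<le> C * norm (fps_nth (power_fps (Suc (k - 1))) n * of_real r ^ n)" .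
  qed
qed

lemma eisenstein_q_eq_eval_fps: "eisenstein_q k q = eval_fps (eisenstein_cfps k) q"
  by (simp add: eisenstein_q_def eval_fps_def eisenstein_cfps_def)

lemma eisenstein_eq: "eisenstein k z = eisenstein_q k (nome z)"
  by (simp add: eisenstein_def nome_def)

text \<open>Grouping the pairs by the product \<open>N = (c + 1)(n + 1)\<close> produces the divisor
  sums; absolute convergence licenses the regrouping.\<close>

lemma has_sum_Lambert:
  fixes q :: complex
  assumes "norm q < 1"
  shows "((\<lambda>(c, n). of_nat (Suc n) ^ l * (q ^ Suc c) ^ Suc n) has_sum
            (\<Sum>n. of_nat (divisor_sum l n) * q ^ n)) UNIV"
proof -
  define f where "f = (\<lambda>(c, n). of_nat (Suc n) ^ l * (q ^ Suc c) ^ Suc n)"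
  define r where "r = norm q"
  have r: "r \<ge> 0" "r < 1" using assms by (auto simp: r_def)
  have "ereal (norm q) < fps_conv_radius (power_fps l)"
    by (intro less_fps_conv_radius_power_fps) fact
  from norm_summable_fps[OF this]
  have "summable (\<lambda>n. norm (fps_nth (power_fps l) (Suc n) * q ^ Suc n))"
    by (subst summable_Suc_iff)
  hence "summable (\<lambda>n. real (Suc n) ^ l * r ^ Suc n)"
    by (simp add: power_fps_def norm_mult norm_power r_def del: of_nat_Suc)
  hence "((\<lambda>n. real (Suc n) ^ l * r ^ Suc n) has_sum (\<Sum>n. real (Suc n) ^ l * r ^ Suc n)) UNIV"
    by (intro sums_nonneg_imp_has_sum summable_sums) (use r in auto)
  moreover have "((\<lambda>n. r ^ n) has_sum (1 / (1 - r))) UNIV"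
    by (intro sums_nonneg_imp_has_sum geometric_sums) (use r in auto)
  ultimately have "(\<lambda>(c, n). r ^ c * (real (Suc n) ^ l * r ^ Suc n)) summable_on UNIV"
    using has_sum_product_nonneg r by (fastforce intro: has_sum_imp_summable)
  hence "(\<lambda>x. norm (f x)) summable_on UNIV"
  proof (rule summable_on_comparison_test)
    fix x :: "nat \<times> nat"
    obtain c n where x: "x = (c, n)" by (cases x)
    \<comment> \<open>\<open>(c + 1)(n + 1) \<ge> c + (n + 1)\<close> decouples the indices, so that
      the majorant is a product of two convergent series.\<close>
    have "r ^ (Suc c * Suc n) \<le> r ^ c * r ^ Suc n"
      unfolding power_add [symmetric] by (rule power_decreasing) (use r in auto)
    thus "norm (f x) \<le> (case x of (c, n) \<Rightarrow> r ^ c * (real (Suc n) ^ l * r ^ Suc n))"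
      by (auto simp: f_def x norm_mult norm_power r_def [symmetric] power_mult [symmetric] power_add
               simp del: of_nat_Suc power_Suc mult_Suc mult_Suc_right intro!: mult_left_mono)
  qed auto
  hence "f summable_on UNIV" by (rule abs_summable_summable)
  then obtain S where S: "(f has_sum S) UNIV" by (auto simp: summable_on_def)
  have div_pos: "d > 0 \<and> N div d > 0 \<and> N div d * d = N" if "d dvd N" "Suc 0 \<le> N" for N d :: nat
    using that by (auto simp: div_greater_zero_iff dvd_imp_le Nat.gr0I)
  have "((\<lambda>(N, d). of_nat d ^ l * q ^ N) has_sum S) (SIGMA N:{1..}. {d. d dvd N}) \<longleftrightarrow> (f has_sum S) UNIV"
    by (rule has_sum_reindex_bij_witness[where j = "\<lambda>(N, d). (N div d - 1, d - 1)" 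
                                           and i = "\<lambda>(c, n). (Suc c * Suc n, Suc n)"])
       (use div_pos in \<open>auto simp: f_def simp flip: power_mult simp del: mult_Suc mult_Suc_right power_Suc of_nat_Suc\<close>)
  with S have "((\<lambda>(N, d). of_nat d ^ l * q ^ N) has_sum S) (SIGMA N:{1..}. {d. d dvd N})"
    by blast
  hence "((\<lambda>N. of_nat (divisor_sum l N) * q ^ N) has_sum S) {1..}"
  proof (rule has_sum_SigmaD)
    fix N :: nat assume "N \<in> {1..}"
    thus "((\<lambda>d. case (N, d) of (N, d) \<Rightarrow> of_nat d ^ l * q ^ N) has_sum of_nat (divisor_sum l N) * q ^ N) {d. d dvd N}"
      by (intro has_sum_finiteI) (auto simp: divisor_sum_def sum_distrib_right)
  qed
  also have "?this \<longleftrightarrow> ((\<lambda>N. of_nat (divisor_sum l N) * q ^ N) has_sum S) UNIV"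
    by (rule has_sum_cong_neutral) (auto simp: divisor_sum_def not_le)
  finally have "S = (\<Sum>n. of_nat (divisor_sum l n) * q ^ n)"
    using has_sum_imp_sums sums_unique by blast
  with S show ?thesis by (simp add: f_def)
qed

lemma eisenstein_q_eq_divisor_series:
  assumes "norm q < 1"
  shows "eisenstein_q k q = 1 - of_real (2 * real k / bernoulli k) * (\<Sum>n. of_nat (divisor_sum (k - 1) n) * q ^ n)"
proof -
  have "(\<lambda>n. of_nat (divisor_sum (k - 1) n) * q ^ n) sums (\<Sum>n. of_nat (divisor_sum (k - 1) n) * q ^ n)"
  proof (rule summable_sums, rule summable_comparison_test'[where N = 0])
    have "ereal (norm q) < fps_conv_radius (power_fps (Suc (k - 1)))"
      by (intro less_fps_conv_radius_power_fps) fact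
    thus "summable (\<lambda>n. norm (fps_nth (power_fps (Suc (k - 1))) n * q ^ n))"
      by (rule norm_summable_fps)
    fix n
    have "real (divisor_sum (k - 1) n) \<le> real n ^ Suc (k - 1)"
      using divisor_sum_le[of "k - 1" n] by (metis of_nat_le_iff of_nat_power)
    thus "norm (of_nat (divisor_sum (k - 1) n) * q ^ n) \<le> norm (fps_nth (power_fps (Suc (k - 1))) n * q ^ n)"
      by (auto simp: norm_mult norm_power power_fps_def simp del: power_Suc intro!: mult_right_mono)
  qed
  hence 1: "(\<lambda>n. - of_real (2 * real k / bernoulli k) * (of_nat (divisor_sum (k - 1) n) * q ^ n)) sums
          (- of_real (2 * real k / bernoulli k) * (\<Sum>n. of_nat (divisor_sum (k - 1) n) * q ^ n))"
    by (rule sums_mult)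
  have 2: "(\<lambda>n. if n = 0 then 1 else 0) sums (1 :: complex)"
    using sums_single[of 0 "\<lambda>_. 1 :: complex"] by (simp add: eq_commute)
  have "(\<lambda>n. of_real (eisenstein_coeff k n) * q ^ n) = 
          (\<lambda>n. (if n = 0 then 1 else 0) + - of_real (2 * real k / bernoulli k) * (of_nat (divisor_sum (k - 1) n) * q ^ n))"
    by (auto simp: eisenstein_coeff_def divisor_sum_def)
  with sums_add[OF 2 1] show ?thesis
    unfolding eisenstein_q_def by (simp add: sums_iff)
qed

lemma nome_mult_of_nat: "nome (of_nat c * z) = nome z ^ c"
  by (simp add: nome_def exp_of_nat_mult [symmetric] mult_ac)

text \<open>Summed over \<open>d\<close> first, the lattice tail is, by the Lipschitz formula, a
  multiple of a Lambert series minus \<open>\<zeta>(k) / z ^ k\<close>. Euler's formula turns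
  \<open>K / \<zeta>(k)\<close> into \<open>- 2k / B_k\<close>.\<close>

theorem eisenstein_eq_lattice:
  assumes "Im z > 0" and "even k" and "k \<ge> 4"
  shows "eisenstein k z = 1 + 1 / z ^ k + lattice_tail k z / of_real (zeta_nat k)"
proof -
  define K where "K = (2 * of_real pi * \<i>) ^ k / (fact (k - 1) :: complex)"
  define S where "S = (\<Sum>n. of_nat (divisor_sum (k - 1) n) * nome z ^ n)"
  have q: "norm (nome z) < 1" by (rule norm_nome_less_1) fact
  have "((\<lambda>(c, n). of_nat (Suc n) ^ (k - 1) * (nome z ^ Suc c) ^ Suc n) has_sum S) (UNIV \<times> UNIV)"
    using has_sum_Lambert[OF q] by (simp add: S_def)
  hence S: "((\<lambda>c. eval_fps (power_fps (k - 1)) (nome z ^ Suc c)) has_sum S) UNIV"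
  proof (rule has_sum_SigmaD)
    fix c :: nat
    have "norm (nome z ^ Suc c) < 1"
      unfolding norm_power by (rule power_Suc_less_one) (use q in \<open>auto simp: nome_def\<close>)
    hence r: "ereal (norm (nome z ^ Suc c)) < fps_conv_radius (power_fps (k - 1))"
      by (intro less_fps_conv_radius_power_fps)
    have "summable (\<lambda>n. norm (fps_nth (power_fps (k - 1)) (Suc n) * (nome z ^ Suc c) ^ Suc n))"
      using norm_summable_fps[OF r] by (subst summable_Suc_iff)
    moreover have "(\<lambda>n. fps_nth (power_fps (k - 1)) (Suc n) * (nome z ^ Suc c) ^ Suc n) sums 
              eval_fps (power_fps (k - 1)) (nome z ^ Suc c)"
      using sums_eval_fps[OF r] by (subst sums_Suc_iff) (simp add: power_fps_def)
    ultimately have "((\<lambda>n. fps_nth (power_fps (k - 1)) (Suc n) * (nome z ^ Suc c) ^ Suc n) has_sum 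
              eval_fps (power_fps (k - 1)) (nome z ^ Suc c)) UNIV"
      by (rule norm_summable_imp_has_sum)
    thus "((\<lambda>n. case (c, n) of (c, n) \<Rightarrow> of_nat (Suc n) ^ (k - 1) * (nome z ^ Suc c) ^ Suc n) has_sum 
              eval_fps (power_fps (k - 1)) (nome z ^ Suc c)) UNIV"
      by (simp add: power_fps_def del: power_Suc of_nat_Suc)
  qed
  have "(lattice_term k z has_sum lattice_tail k z) (UNIV \<times> UNIV)"
    using lattice_term_summable[OF assms] by (simp add: lattice_tail_def)
  hence "((\<lambda>c. K * eval_fps (power_fps (k - 1)) (nome z ^ Suc c) - 1 / (of_nat (Suc c) * z) ^ k) has_sum lattice_tail k z) UNIV"
  proof (rule has_sum_SigmaD)
    fix c :: nat
    have "Im (of_nat (Suc c) * z) > 0" using assms by simp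
    from Lipschitz_formula[OF this assms(2)] assms(3)
    have "(\<lambda>d. lattice_term k z (c, d)) sums (K * eval_fps (power_fps (k - 1)) (nome z ^ Suc c) - 1 / (of_nat (Suc c) * z) ^ k)"
      unfolding nome_mult_of_nat by (simp add: K_def lattice_term_def del: of_nat_Suc power_Suc)
    moreover have "(\<lambda>x. norm (lattice_term k z x)) summable_on (UNIV \<times> UNIV)"
      using lattice_term_abs_summable[OF assms] by simp
    hence "(\<lambda>d. norm (lattice_term k z (c, d))) summable_on UNIV"
      using summable_on_SigmaD1[where f = "\<lambda>c d. norm (lattice_term k z (c, d))" and A = UNIV and B = "\<lambda>_. UNIV" and x = c]
      by (simp add: case_prod_unfold)
    hence "summable (\<lambda>d. norm (lattice_term k z (c, d)))"
      by (rule summable_on_imp_summable)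
    ultimately show "((\<lambda>d. lattice_term k z (c, d)) has_sum 
        (K * eval_fps (power_fps (k - 1)) (nome z ^ Suc c) - 1 / (of_nat (Suc c) * z) ^ k)) UNIV"
      by (intro norm_summable_imp_has_sum)
  qed
  moreover have "((\<lambda>c. K * eval_fps (power_fps (k - 1)) (nome z ^ Suc c) - of_real (1 / real (Suc c) ^ k) / z ^ k) has_sum 
                    (K * S - of_real (zeta_nat k) / z ^ k)) UNIV"
  proof -
    have "((\<lambda>c. 1 / real (Suc c) ^ k) has_sum zeta_nat k) UNIV"
      by (intro sums_nonneg_imp_has_sum zeta_nat_sums) (use assms in auto)
    hence "((\<lambda>c. complex_of_real (1 / real (Suc c) ^ k) * (1 / z ^ k)) has_sum (of_real (zeta_nat k) * (1 / z ^ k))) UNIV"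
      by (intro has_sum_cmult_left has_sum_of_real)
    from has_sum_add[OF has_sum_cmult_right[OF S, of K] has_sum_cmult_right[OF this, of "-1"]]
    show ?thesis by simp
  qed
  hence "((\<lambda>c. K * eval_fps (power_fps (k - 1)) (nome z ^ Suc c) - 1 / (of_nat (Suc c) * z) ^ k) has_sum 
                    (K * S - of_real (zeta_nat k) / z ^ k)) UNIV"
    by (simp add: power_mult_distrib del: of_nat_Suc power_Suc)
  ultimately have T: "lattice_tail k z = K * S - of_real (zeta_nat k) / z ^ k"
    by (rule has_sum_unique)
  have ze: "zeta_nat k \<noteq> 0" using zeta_nat_ge_1[of k] assms by simp
  define a where "a = (2 * complex_of_real pi * \<i>) ^ k"
  have az: "2 * complex_of_real (zeta_nat k) = - (a * of_real (bernoulli k / fact k))"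
    using zeta_nat_even[of k] assms by (simp add: a_def)
  \<comment> \<open>A vanishing Bernoulli number would make \<open>2k / B_k\<close> the default
    value \<open>0\<close>; Euler's formula and \<open>\<zeta>(k) \<noteq> 0\<close> exclude
    it.\<close>
  have bn: "bernoulli k \<noteq> 0" using az ze by auto
  have "(fact k :: complex) = of_nat k * fact (k - 1)"
    using assms by (cases k) auto
  hence "of_real (2 * real k / bernoulli k) * (2 * complex_of_real (zeta_nat k)) = - 2 * K"
    unfolding az K_def a_def [symmetric] using bn assms by (simp add: field_simps)
  moreover define Q where "Q = complex_of_real (2 * real k / bernoulli k)"
  ultimately have "2 * (- Q * of_real (zeta_nat k)) = 2 * K"
    by simp
  hence "- Q * of_real (zeta_nat k) = K"
    by (subst (asm) mult_cancel_left) simp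
  hence "- of_real (2 * real k / bernoulli k) = K / of_real (zeta_nat k)"
    unfolding Q_def [symmetric] using ze by (simp add: field_simps)
  note Q = this
  have "eisenstein k z = 1 + (- of_real (2 * real k / bernoulli k)) * S"
    unfolding eisenstein_eq eisenstein_q_eq_divisor_series[OF q] S_def by simp
  also have "\<dots> = 1 + 1 / z ^ k + lattice_tail k z / of_real (zeta_nat k)"
    unfolding T Q using ze by (simp add: diff_divide_distrib)
  finally show ?thesis .
qed

lemma eisenstein_inversion:
  assumes "Im z > 0" and "even k" and "k \<ge> 4"
  shows "eisenstein k (- 1 / z) = z ^ k * eisenstein k z"
proof -
  have z: "z \<noteq> 0" using assms by auto
  have "Im (- 1 / z) > 0" using assms by (simp add: Im_divide divide_pos_pos sum_power2_gt_zero_iff)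
  from eisenstein_eq_lattice[OF this assms(2,3)]
  have "eisenstein k (- 1 / z) = 1 + z ^ k + z ^ k * lattice_tail k z / of_real (zeta_nat k)"
    unfolding lattice_tail_inversion[OF z assms(2)] using assms(2) by (simp add: power_divide)
  thus ?thesis
    unfolding eisenstein_eq_lattice[OF assms] using z by (simp add: algebra_simps)
qed

subsection \<open>Bounds for the tail of the lattice sum\<close>

text \<open>Here \<open>C^2 + D^2 \<ge> 2 C D\<close> and the cross term \<open>2 C D Re z\<close>
  helps; with a minus sign instead, it costs at most \<open>C D\<close>.\<close>

lemma norm_sq_plus_ge:
  fixes C D :: real
  assumes "0 \<le> Re z" "1 \<le> norm z" "C \<ge> 0" "D \<ge> 0"
  shows "2 * (C * D) \<le> norm (of_real C * z + of_real D) ^ 2"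
proof -
  have "norm (of_real C * z + of_real D) ^ 2 = C ^ 2 * norm z ^ 2 + 2 * (C * D * Re z) + D ^ 2"
    unfolding cmod_power2 by (simp add: power2_eq_square algebra_simps)
  moreover have "C ^ 2 * 1 \<le> C ^ 2 * norm z ^ 2"
    using assms by (intro mult_left_mono) auto
  moreover have "0 \<le> C * D * Re z" using assms by simp
  moreover have "0 \<le> (C - D) ^ 2" by simp
  ultimately show ?thesis by (simp add: power2_diff)
qed

lemma norm_sq_minus_ge:
  fixes C D :: real
  assumes "Re z \<le> 1 / 2" "1 \<le> norm z" "C \<ge> 0" "D \<ge> 0"
  shows "C * D \<le> norm (of_real C * z - of_real D) ^ 2"
proof -
  have "norm (of_real C * z - of_real D) ^ 2 = C ^ 2 * norm z ^ 2 - 2 * (C * D * Re z) + D ^ 2"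
    unfolding cmod_power2 by (simp add: power2_eq_square algebra_simps)
  moreover have "C ^ 2 * 1 \<le> C ^ 2 * norm z ^ 2"
    using assms by (intro mult_left_mono) auto
  moreover have "C * D * Re z \<le> C * D * (1 / 2)" using assms by (intro mult_left_mono) auto
  moreover have "0 \<le> (C - D) ^ 2" by simp
  ultimately show ?thesis by (simp add: power2_diff)
qed

text \<open>For \<open>z\<close> in the right half of the strip outside the unit circle, \<open>\<bar>cz + d\<bar>\<^sup>2 \<ge> 2cd\<close> and
  \<open>\<bar>cz - d\<bar>\<^sup>2 \<ge> cd\<close>; the only term that can be close to \<open>1\<close> is the one with \<open>c = d = 1\<close>, for which
  \<open>v\<close> is a separate lower bound for \<open>\<bar>z - 1\<bar>\<^sup>2\<close>.\<close>

definition tail_majorant :: "nat \<Rightarrow> real \<Rightarrow> nat \<times> nat \<Rightarrow> real" where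
  "tail_majorant m v = (\<lambda>(c, d). 1 / (2 * (real (Suc c) * real (Suc d))) ^ m +
      (if c = 0 \<and> d = 0 then 1 / v ^ m else 1 / (real (Suc c) * real (Suc d)) ^ m))"

lemma lattice_norm_term_le_majorant:
  assumes "0 \<le> Re z" "Re z \<le> 1 / 2" "1 \<le> norm z" "0 < v" "v \<le> norm (z - 1) ^ 2"
  shows "lattice_norm_term (2 * m) z x \<le> tail_majorant m v x"
proof -
  obtain c d where x: "x = (c, d)" by (cases x)
  let ?C = "real (Suc c)" and ?D = "real (Suc d)"
  have CD: "?C * ?D > 0" by simp
  have 1: "1 / norm (of_nat (Suc c) * z + of_nat (Suc d)) ^ (2 * m) \<le> 1 / (2 * (?C * ?D)) ^ m"
  proof -
    have le: "2 * (?C * ?D) \<le> norm (of_real ?C * z + of_real ?D) ^ 2"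
      by (rule norm_sq_plus_ge) (use assms in auto)
    have "(2 * (?C * ?D)) ^ m \<le> (norm (of_real ?C * z + of_real ?D) ^ 2) ^ m"
      using le CD by (intro power_mono) auto
    moreover have "(2 * (?C * ?D)) ^ m > 0" using CD by simp
    ultimately show ?thesis
      unfolding power_mult of_real_of_nat_eq by (intro divide_left_mono mult_pos_pos) linarith+
  qed
  have 2: "1 / norm (of_nat (Suc c) * z - of_nat (Suc d)) ^ (2 * m) \<le> 
             (if c = 0 \<and> d = 0 then 1 / v ^ m else 1 / (?C * ?D) ^ m)"
  proof (cases "c = 0 \<and> d = 0")
    case True
    have "v ^ m \<le> (norm (z - 1) ^ 2) ^ m" using assms by (intro power_mono) auto
    moreover have "v ^ m > 0" using assms by simp
    ultimately have "1 / (norm (z - 1) ^ 2) ^ m \<le> 1 / v ^ m"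
      by (intro divide_left_mono mult_pos_pos) linarith+
    thus ?thesis using True by (simp add: power_mult)
  next
    case False
    have le: "?C * ?D \<le> norm (of_real ?C * z - of_real ?D) ^ 2"
      by (rule norm_sq_minus_ge) (use assms in auto)
    have "(?C * ?D) ^ m \<le> (norm (of_real ?C * z - of_real ?D) ^ 2) ^ m"
      using le CD by (intro power_mono) auto
    moreover have "(?C * ?D) ^ m > 0" using CD by simp
    ultimately have "1 / norm (of_nat (Suc c) * z - of_nat (Suc d)) ^ (2 * m) \<le> 1 / (?C * ?D) ^ m"
      unfolding power_mult of_real_of_nat_eq by (intro divide_left_mono mult_pos_pos) linarith+
    thus ?thesis using False by auto
  qed
  show ?thesis unfolding x lattice_norm_term_def tail_majorant_def prod.case using 1 2 by (rule add_mono)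
qed

text \<open>From \<open>n = 3\<close> on, \<open>n^-6 \<le> n^-2 / 81\<close>, and the Basel sum
  bounds what remains. The first two terms add up to \<open>65/64\<close> for exponent
  \<open>6\<close> and to \<open>5/4\<close> for exponent \<open>2\<close>.\<close>

lemma zeta_nat_6_less: "zeta_nat 6 \<le> 10206 / 10000"
proof -
  have s2: "(\<lambda>n. 1 / real (Suc n) ^ 2) sums (pi\<^sup>2 / 6)"
    using inverse_squares_sums by (simp add: add.commute)
  have s2': "(\<lambda>n. 1 / real (Suc (n + 2)) ^ 2) sums (pi\<^sup>2 / 6 - 5 / 4)"
    using sums_split_initial_segment[OF s2, of 2] by (simp add: numeral_2_eq_2)
  have "(\<lambda>n. 1 / real (Suc n) ^ 6) sums zeta_nat 6" by (rule zeta_nat_sums) simp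
  from sums_split_initial_segment[OF this, of 2]
  have s6: "(\<lambda>n. 1 / real (Suc (n + 2)) ^ 6) sums (zeta_nat 6 - 65 / 64)"
    by (simp add: numeral_2_eq_2)
  have "zeta_nat 6 - 65 / 64 \<le> (1 / 81) * (pi\<^sup>2 / 6 - 5 / 4)"
  proof (rule sums_le[OF _ s6 sums_mult[OF s2']])
    fix n :: nat
    have "real (Suc (n + 2)) ^ 4 \<ge> 3 ^ 4" by (intro power_mono) auto
    hence "81 * real (Suc (n + 2)) ^ 2 \<le> real (Suc (n + 2)) ^ 4 * real (Suc (n + 2)) ^ 2"
      by (intro mult_right_mono) auto
    also have "\<dots> = real (Suc (n + 2)) ^ 6" by (simp flip: power_add)
    finally show "1 / real (Suc (n + 2)) ^ 6 \<le> (1 / 81) * (1 / real (Suc (n + 2)) ^ 2)"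
      by (simp add: field_simps)
  qed
  moreover have "pi * pi \<le> 3.142 * 3.142" using pi_approx by (intro mult_mono) auto
  ultimately show ?thesis by (simp add: power2_eq_square)
qed

text \<open>Every base other than \<open>v\<close> is at least \<open>2\<close>, hence at least
  \<open>v\<close>, so a factor \<open>v^-(m - 6)\<close> comes out of each term and exponent
  \<open>6\<close> is left. There the sum is \<open>(65/64) \<zeta>(6)^2\<close>, with the summand
  \<open>1\<close> at \<open>(0, 0)\<close> replaced by \<open>1 / v^6\<close> through
  \<open>h\<close>; \<open>58/1000\<close> bounds \<open>(65/64) 1.0206^2 - 1\<close>.\<close>

lemma tail_majorant_sum:
  assumes "m \<ge> 6" "1 \<le> v" "v \<le> 2"
  shows "tail_majorant m v summable_on UNIV"
    and "infsum (tail_majorant m v) UNIV \<le> (58 / 1000 + 1 / v ^ 6) / v ^ (m - 6)"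
proof -
  define P where "P = (\<lambda>(c :: nat, d :: nat). 1 / (real (Suc c) * real (Suc d)) ^ 6)"
  have P: "(P has_sum (zeta_nat 6 ^ 2)) UNIV"
    unfolding P_def by (rule has_sum_inverse_power_product) simp
  define h where "h = (\<lambda>x :: nat \<times> nat. if x = (0, 0) then 1 / v ^ 6 - 1 else 0)"
  have h: "(h has_sum (1 / v ^ 6 - 1)) UNIV"
  proof -
    have "(h has_sum (1 / v ^ 6 - 1)) {(0, 0)}" by (intro has_sum_finiteI) (auto simp: h_def)
    thus ?thesis by (rule has_sum_cong_neutral[THEN iffD1, rotated -1]) (auto simp: h_def)
  qed
  define T where "T = (1 / 64 * zeta_nat 6 ^ 2 + zeta_nat 6 ^ 2) + (1 / v ^ 6 - 1)"
  have "((\<lambda>x. (1 / 64 * P x + P x) + h x) has_sum T) UNIV"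
    unfolding T_def by (intro has_sum_add has_sum_cmult_right P h)
  hence S: "((\<lambda>x. ((1 / 64 * P x + P x) + h x) * (1 / v ^ (m - 6))) has_sum (T * (1 / v ^ (m - 6)))) UNIV"
    by (rule has_sum_cmult_left)
  have inv: "1 / N ^ m \<le> 1 / N ^ 6 * (1 / v ^ (m - 6))" if "N \<ge> v" for N
  proof -
    have "N ^ m = N ^ 6 * N ^ (m - 6)" using assms by (simp flip: power_add)
    moreover have "v ^ (m - 6) \<le> N ^ (m - 6)" using that assms by (intro power_mono) auto
    moreover have "v ^ (m - 6) > 0" "N ^ 6 > 0" using that assms by auto
    ultimately show ?thesis by (auto simp: divide_simps intro!: mult_left_mono)
  qed
  have le: "tail_majorant m v x \<le> ((1 / 64 * P x + P x) + h x) * (1 / v ^ (m - 6))" for x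
  proof -
    obtain c d where x: "x = (c, d)" by (cases x)
    let ?CD = "real (Suc c) * real (Suc d)"
    have CD: "?CD \<ge> 1" "c = 0 \<and> d = 0 \<or> ?CD \<ge> 2"
    proof -
      have "1 \<le> Suc c * Suc d" by simp
      hence "real 1 \<le> real (Suc c * Suc d)" by (subst of_nat_le_iff)
      thus "?CD \<ge> 1" by (simp only: of_nat_mult of_nat_1)
      have "c = 0 \<and> d = 0 \<or> 2 \<le> Suc c * Suc d" by (cases c; cases d) auto
      hence "c = 0 \<and> d = 0 \<or> real 2 \<le> real (Suc c * Suc d)" by (subst of_nat_le_iff)
      thus "c = 0 \<and> d = 0 \<or> ?CD \<ge> 2" by (simp only: of_nat_mult of_nat_numeral)
    qed
    have "1 / (2 * ?CD) ^ m \<le> 1 / (2 * ?CD) ^ 6 * (1 / v ^ (m - 6))"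
      by (rule inv) (use CD(1) assms in linarith)
    moreover have "1 / (2 * ?CD) ^ 6 = 1 / 64 * P x"
      by (simp add: P_def x power_mult_distrib)
    moreover have "(if c = 0 \<and> d = 0 then 1 / v ^ m else 1 / ?CD ^ m) \<le> (P x + h x) * (1 / v ^ (m - 6))"
    proof (cases "c = 0 \<and> d = 0")
      case True
      thus ?thesis using inv[of v] by (simp add: P_def h_def x)
    next
      case False
      hence "?CD \<ge> v" using CD assms by linarith
      from inv[OF this] show ?thesis using False by (auto simp: P_def h_def x)
    qed
    ultimately have "1 / (2 * ?CD) ^ m + (if c = 0 \<and> d = 0 then 1 / v ^ m else 1 / ?CD ^ m)
        \<le> 1 / 64 * P x * (1 / v ^ (m - 6)) + (P x + h x) * (1 / v ^ (m - 6))"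
      by (intro add_mono) (simp_all only:)
    thus ?thesis
      unfolding tail_majorant_def x prod.case by (simp only: distrib_right add.assoc)
  qed
  show sm: "tail_majorant m v summable_on UNIV"
    by (rule summable_on_comparison_test[OF has_sum_imp_summable[OF S] le])
       (use assms in \<open>auto simp: tail_majorant_def\<close>)
  have "infsum (tail_majorant m v) UNIV \<le> T * (1 / v ^ (m - 6))"
    by (rule has_sum_mono[OF has_sum_infsum[OF sm] S]) (rule le)
  also have "T \<le> 58 / 1000 + 1 / v ^ 6"
  proof -
    have "zeta_nat 6 ^ 2 \<le> (10206 / 10000) ^ 2"
      using zeta_nat_6_less zeta_nat_ge_1[of 6] by (intro power_mono) auto
    thus ?thesis unfolding T_def by (simp add: power2_eq_square)
  qed
  hence "T * (1 / v ^ (m - 6)) \<le> (58 / 1000 + 1 / v ^ 6) / v ^ (m - 6)"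
    using assms by (simp add: divide_right_mono)
  finally show "infsum (tail_majorant m v) UNIV \<le> (58 / 1000 + 1 / v ^ 6) / v ^ (m - 6)" .
qed

definition eisenstein_rest :: "nat \<Rightarrow> complex \<Rightarrow> complex" where
  "eisenstein_rest k z = lattice_tail k z / of_real (zeta_nat k)"

lemma norm_divide_zeta_nat_le: "k \<ge> 2 \<Longrightarrow> norm (w / complex_of_real (zeta_nat k)) \<le> norm w"
  using zeta_nat_ge_1[of k] by (simp add: norm_divide divide_le_eq mult_le_cancel_left1 not_less)

lemma norm_eisenstein_rest_le:
  assumes "0 \<le> Re z" "Re z \<le> 1 / 2" "1 \<le> norm z" "Im z > 0" "1 \<le> v" "v \<le> 2" "v \<le> norm (z - 1) ^ 2"
    and "m \<ge> 6"
  shows "norm (eisenstein_rest (2 * m) z) \<le> (58 / 1000 + 1 / v ^ 6) / v ^ (m - 6)"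
proof -
  have "norm (eisenstein_rest (2 * m) z) \<le> norm (lattice_tail (2 * m) z)"
    unfolding eisenstein_rest_def using assms by (intro norm_divide_zeta_nat_le) auto
  also have "\<dots> \<le> infsum (tail_majorant m v) UNIV"
    unfolding lattice_tail_def
  proof (rule norm_infsum_le)
    show "(lattice_term (2 * m) z has_sum infsum (lattice_term (2 * m) z) UNIV) UNIV"
      using assms by (intro has_sum_infsum lattice_term_summable) auto
    show "(tail_majorant m v has_sum infsum (tail_majorant m v) UNIV) UNIV"
      using assms by (intro has_sum_infsum tail_majorant_sum) auto
    show "norm (lattice_term (2 * m) z x) \<le> tail_majorant m v x" for x
      by (rule order.trans[OF norm_lattice_term_le lattice_norm_term_le_majorant]) (use assms in auto)
  qed
  also have "\<dots> \<le> (58 / 1000 + 1 / v ^ 6) / v ^ (m - 6)"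
    using assms by (intro tail_majorant_sum) auto
  finally show ?thesis .
qed

subsection \<open>Zeros of large imaginary part\<close>

lemma has_sum_diff:
  fixes f g :: "'a \<Rightarrow> 'b :: real_normed_vector"
  assumes "(f has_sum a) A" "(g has_sum b) A"
  shows "((\<lambda>x. f x - g x) has_sum (a - b)) A"
proof -
  have "((\<lambda>x. - g x) has_sum (- b)) A" using assms(2) by (simp add: has_sum_uminus)
  from has_sum_add[OF assms(1) this] show ?thesis by simp
qed

section \<open>Trigonometric inequalities and angular sectors\<close>

lemma mult_cos_le_sin:
  fixes x :: real
  assumes "0 \<le> x" "x \<le> pi"
  shows "x * cos x \<le> sin x"
proof -
  have "sin 0 - 0 * cos 0 \<le> sin x - x * cos x"
  proof (rule DERIV_nonneg_imp_nondecreasing[OF assms(1)])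
    fix t assume t: "0 \<le> t" "t \<le> x"
    have "((\<lambda>x. sin x - x * cos x) has_real_derivative t * sin t) (at t)"
      by (auto intro!: derivative_eq_intros)
    moreover have "t * sin t \<ge> 0" using t assms by (intro mult_nonneg_nonneg sin_ge_zero) auto
    ultimately show "\<exists>y. ((\<lambda>x. sin x - x * cos x) has_real_derivative y) (at t) \<and> 0 \<le> y" by blast
  qed
  thus ?thesis by simp
qed

text \<open>The inequality \<open>u \<le> tan u\<close>, squared. It bounds the height of a point at
  a large angle from above, while \<open>1 - u^2\<close> bounds \<open>(cos u)^2\<close> from
  below.\<close>

lemma cos_sq_times_le_1:
  fixes u :: real
  assumes "0 \<le> u" "u < pi / 2"
  shows "(cos u)\<^sup>2 * (1 + u\<^sup>2) \<le> 1"
proof -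
  have "(u * cos u)\<^sup>2 \<le> (sin u)\<^sup>2"
    using assms cos_ge_zero[of u] by (intro power_mono mult_cos_le_sin mult_nonneg_nonneg) auto
  thus ?thesis by (simp add: power_mult_distrib algebra_simps sin_squared_eq)
qed

lemma cos_sq_ge: 
  fixes u :: real
  shows "0 \<le> u \<Longrightarrow> u \<le> pi \<Longrightarrow> 1 - u\<^sup>2 \<le> (cos u)\<^sup>2"
proof -
  assume "0 \<le> u" "u \<le> pi"
  hence "(sin u)\<^sup>2 \<le> u\<^sup>2" by (intro power_mono sin_x_le_x sin_ge_zero) auto
  thus ?thesis by (simp add: cos_squared_eq)
qed

text \<open>The tangents from the origin to the circle of radius \<open>1/2\<close> about
  \<open>1\<close> make the angle \<open>pi/6\<close> with the real axis, because its sine is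
  \<open>1/2\<close>. Algebraically this is \<open>(r - sqrt 3 / 2)^2 \<ge> 0\<close>.\<close>

lemma cos_ge_if_near_1:
  assumes "r > 0" "norm (1 - of_real r * cis \<eta>) \<le> 1 / 2"
  shows "cos \<eta> \<ge> sqrt 3 / 2"
proof -
  have "norm (1 - of_real r * cis \<eta>) ^ 2 \<le> (1 / 2) ^ 2"
    using assms by (intro power_mono) auto
  also have "norm (1 - of_real r * cis \<eta>) ^ 2 = 1 - 2 * r * cos \<eta> + ((r * sin \<eta>)\<^sup>2 + (r * cos \<eta>)\<^sup>2)"
    unfolding cmod_power2 by (simp add: power2_diff)
  also have "(r * sin \<eta>)\<^sup>2 + (r * cos \<eta>)\<^sup>2 = r ^ 2"
    by (simp add: power_mult_distrib flip: distrib_left)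
  finally have "3 / 4 + r ^ 2 \<le> 2 * r * cos \<eta>" by (simp add: power2_eq_square)
  moreover have "0 \<le> (r - sqrt 3 / 2) ^ 2" by simp
  hence "sqrt 3 * r \<le> 3 / 4 + r ^ 2" by (simp add: power2_diff power_divide mult.commute add.commute)
  ultimately have "sqrt 3 * r \<le> 2 * cos \<eta> * r" by (simp add: algebra_simps)
  thus ?thesis using assms(1) by simp
qed

lemma abs_Im_Ln_le:
  assumes "norm (1 - w) \<le> 1 / 2"
  shows "\<bar>Im (Ln w)\<bar> \<le> pi / 6"
proof (rule ccontr)
  assume *: "\<not> \<bar>Im (Ln w)\<bar> \<le> pi / 6"
  have w: "w \<noteq> 0" using assms by auto
  have "w = of_real (norm w) * cis (Im (Ln w))"
    using w exp_eq_polar[of "Ln w"] by (simp add: norm_exp_eq_Re[symmetric] exp_Ln)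
  with assms have "norm (1 - of_real (norm w) * cis (Im (Ln w))) \<le> 1 / 2" by simp
  hence "cos (Im (Ln w)) \<ge> sqrt 3 / 2" using w by (intro cos_ge_if_near_1) auto
  moreover have "cos \<bar>Im (Ln w)\<bar> < cos (pi / 6)"
  proof (rule cos_monotone_0_pi)
    show "\<bar>Im (Ln w)\<bar> \<le> pi" using mpi_less_Im_Ln[OF w] Im_Ln_le_pi[OF w] by simp
  qed (use * in auto)
  ultimately show False by (simp add: cos_30)
qed

text \<open>The next interval on which the cosine is that negative starts at
  \<open>17 pi / 6\<close>, beyond \<open>5 pi / 2\<close>.\<close>

lemma angle_near_pi:
  fixes \<theta> :: real
  assumes "0 \<le> \<theta>" "\<theta> < 5 * pi / 2" "- cos \<theta> \<ge> sqrt 3 / 2"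
  shows "5 * pi / 6 \<le> \<theta>" "\<theta> \<le> 7 * pi / 6"
proof -
  have c: "cos (5 * pi / 6) = - (sqrt 3 / 2)"
  proof -
    have "cos (5 * pi / 6) = cos (pi - pi / 6)" by (simp add: field_simps)
    thus ?thesis unfolding cos_diff by (simp add: cos_30)
  qed
  have aux: False if "0 \<le> t" "t < 5 * pi / 6" "- cos t \<ge> sqrt 3 / 2" for t
    using cos_monotone_0_pi[of t "5 * pi / 6"] that c by simp
  show "5 * pi / 6 \<le> \<theta>" using aux[of \<theta>] assms by (meson not_le)
  show "\<theta> \<le> 7 * pi / 6"
  proof (rule ccontr)
    assume *: "\<not> \<theta> \<le> 7 * pi / 6"
    show False
    proof (cases "\<theta> \<le> 2 * pi")
      case True
      thus False using aux[of "2 * pi - \<theta>"] * assms by (simp add: cos_diff)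
    next
      case False
      have "cos (\<theta> - 2 * pi) \<ge> 0" by (rule cos_ge_zero) (use False assms in auto)
      hence "cos \<theta> \<ge> 0" by (simp add: cos_diff)
      moreover have "sqrt 3 > 0" by simp
      ultimately show False using assms by linarith
    qed
  qed
qed

lemma upper_half_plane_polar:
  assumes "Im z > 0" "Re z \<ge> 0"
  obtains t where "0 \<le> t" "t < pi / 2" "z = of_real (norm z) * (\<i> * cis (- t))"
proof -
  have z: "z \<noteq> 0" using assms by auto
  have 1: "0 < Im (Ln z)" "Im (Ln z) < pi" using Im_Ln_pos_lt_imp[OF assms(1)] by auto
  have 2: "\<bar>Im (Ln z)\<bar> \<le> pi / 2" using Re_Ln_pos_le[OF z] assms by simp
  have i: "\<i> = cis (pi / 2)" by (simp add: complex_eq_iff)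
  have "z = of_real (norm z) * cis (Im (Ln z))"
    using z exp_eq_polar[of "Ln z"] by (simp add: norm_exp_eq_Re[symmetric] exp_Ln)
  also have "cis (Im (Ln z)) = \<i> * cis (- (pi / 2 - Im (Ln z)))"
    unfolding i cis_mult by simp
  finally show ?thesis using 1 2 by (intro that[of "pi / 2 - Im (Ln z)"]) auto
qed

section \<open>The coordinate \<open>v\<close> in weight \<open>k = 2m\<close> with \<open>m\<close>
  even\<close>

locale high_weight =
  fixes k m :: nat
  assumes k_eq: "k = 2 * m" and even_m: "even m" and m_ge: "m \<ge> 6"
begin

lemma fold_k: "2 * m = k" using k_eq by simp
lemma k_ge: "k \<ge> 12" using k_eq m_ge by simp
lemma even_k: "even k" using k_eq by simp

lemma i_power_k [simp]: "\<i> ^ k = 1"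
  using even_m by (simp add: k_eq power_mult)

lemma polar_power_k: "(of_real r * (\<i> * cis (- t))) ^ k = of_real (r ^ k) * cis (- (real k * t))"
  using Complex.DeMoivre[of "- t" k] by (simp add: power_mult_distrib)

lemma eisenstein_eq_rest:
  "Im z > 0 \<Longrightarrow> eisenstein k z = 1 + 1 / z ^ k + eisenstein_rest k z"
  using eisenstein_eq_lattice[of z k] even_k k_ge by (simp add: eisenstein_rest_def)

text \<open>Angles are measured from the imaginary axis. On the unit circle the main term
  \<open>1 + z\<^sup>-\<^sup>k\<close> vanishes first at the angle \<open>\<pi>/k\<close>, and the highest zero has its angle in the bracket
  between \<open>5\<pi>/(6k)\<close> and \<open>7\<pi>/(6k)\<close>.\<close>

definition low_angle :: real where "low_angle = 7 * pi / 6 / k"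

lemma low_angle: "0 < low_angle" "low_angle \<le> 306 / 1000" "low_angle < pi / 2"
proof -
  have "low_angle \<le> 7 * pi / 6 / 12" unfolding low_angle_def using k_ge by (intro divide_left_mono) auto
  thus "low_angle \<le> 306 / 1000" "low_angle < pi / 2" using pi_approx by simp_all
  show "low_angle > 0" using k_ge by (simp add: low_angle_def)
qed

lemma cos_low_angle: "(cos low_angle)\<^sup>2 \<ge> 906 / 1000" "cos low_angle \<ge> 95 / 100"
proof -
  have "low_angle\<^sup>2 \<le> (306 / 1000)\<^sup>2" using low_angle by (intro power_mono) auto
  thus 1: "(cos low_angle)\<^sup>2 \<ge> 906 / 1000"
    using cos_sq_ge[of low_angle] low_angle pi_approx by (simp add: power2_eq_square)
  have "cos low_angle \<ge> 0" using low_angle by (intro cos_ge_zero) auto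
  moreover have "(95 / 100)\<^sup>2 \<le> (cos low_angle)\<^sup>2" using 1 by (simp add: power2_eq_square)
  ultimately show "cos low_angle \<ge> 95 / 100" by (rule power2_le_imp_le[rotated])
qed

text \<open>\<open>r \<le> 11/10\<close> because \<open>1.1^12 > 2\<close>, and
  \<open>sin t \<le> t \<le> 7 pi / 72 < 306/1000\<close>. Hence
  \<open>|z - 1|^2 = 1 + r (r - 2 sin t) \<ge> 1.388\<close>.\<close>

lemma zone_facts:
  assumes z: "z = of_real r * (\<i> * cis (- t))" and r: "1 \<le> r" "r ^ k \<le> 2"
    and t: "5 * pi / 6 \<le> real k * t" "real k * t \<le> 7 * pi / 6"
  shows "0 < Re z" "Re z \<le> 1 / 2" "norm z = r" "Im z = r * cos t" "cos t \<ge> 95 / 100" "138 / 100 \<le> norm (z - 1) ^ 2"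
    "0 < t" "t \<le> low_angle"
proof -
  show t0: "0 < t"
  proof (rule ccontr)
    assume "\<not> 0 < t"
    hence "real k * t \<le> 0" by (intro mult_nonneg_nonpos) auto
    thus False using t pi_gt_zero by linarith
  qed
  show t1: "t \<le> low_angle" using t k_ge by (simp add: low_angle_def field_simps)
  have s: "0 < sin t" "sin t \<le> 306 / 1000"
    using sin_gt_zero[of t] sin_x_le_x[of t] t0 t1 low_angle pi_approx by auto
  have "cos low_angle \<le> cos t" using t0 t1 low_angle by (intro cos_monotone_0_pi_le) auto
  thus c: "cos t \<ge> 95 / 100" using cos_low_angle by linarith
  have rr: "r \<le> 11 / 10"
  proof (rule ccontr)
    assume *: "\<not> r \<le> 11 / 10"
    have "(11 / 10) ^ 12 \<le> (11 / 10 :: real) ^ k" using k_ge by (intro power_increasing) auto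
    also have "\<dots> \<le> r ^ k" using * by (intro power_mono) auto
    finally show False using r by (simp add: power_numeral_reduce)
  qed
  have zz: "Re z = r * sin t" "Im z = r * cos t" by (simp_all add: z)
  show "Im z = r * cos t" by (rule zz)
  show "0 < Re z" using zz r s by simp
  have "r * sin t \<le> 11 / 10 * (306 / 1000)" using s r rr by (intro mult_mono) auto
  thus "Re z \<le> 1 / 2" using zz by simp
  show "norm z = r" using r by (simp add: z norm_mult)
  have "norm (z - 1) ^ 2 = ((r * sin t)\<^sup>2 + (r * cos t)\<^sup>2) - 2 * r * sin t + 1"
    unfolding cmod_power2 by (simp add: zz power2_diff)
  also have "(r * sin t)\<^sup>2 + (r * cos t)\<^sup>2 = r ^ 2"
    by (simp add: power_mult_distrib flip: distrib_left)
  finally have n: "norm (z - 1) ^ 2 = r * (r - 2 * sin t) + 1" by (simp add: power2_eq_square algebra_simps)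
  have "1 * (388 / 1000) \<le> r * (r - 2 * sin t)" using r s by (intro mult_mono) auto
  thus "138 / 100 \<le> norm (z - 1) ^ 2" using n by simp
qed

text \<open>The radius \<open>1/2\<close> exceeds the bound \<open>478/1000\<close> for the tail at
  the zeros in question, and it confines the argument of \<open>1 - v\<close> to
  \<open>[-pi/6, pi/6]\<close>, which is the origin of the bracket for the angle.\<close>

definition zone :: "complex set" where "zone = cball 0 (1 / 2) \<inter> cball 1 1"

text \<open>The branch of the inverse of \<open>z \<mapsto> 1 + z\<^sup>-\<^sup>k\<close> that sends \<open>0\<close> to \<open>\<i> e\<^sup>-\<^sup>\<i>\<^sup>\<pi>\<^sup>/\<^sup>k\<close>. The condition
  \<open>\<bar>1 - v\<bar> \<le> 1\<close> in the definition of the zone says that its image lies outside the open unit disc.\<close>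

definition zone_map :: "complex \<Rightarrow> complex" where
  "zone_map v = \<i> * exp (- (Ln (1 - v) + \<i> * pi) / k)"

lemma zone_iff: "v \<in> zone \<longleftrightarrow> norm v \<le> 1 / 2 \<and> norm (1 - v) \<le> 1"
  by (auto simp: zone_def dist_norm norm_minus_commute)

lemma convex_zone: "convex zone"
  unfolding zone_def by (intro convex_Int convex_cball)

lemma zone_one_minus: "v \<in> zone \<Longrightarrow> 1 - v \<notin> \<real>\<^sub>\<le>\<^sub>0" "v \<in> zone \<Longrightarrow> norm (1 - v) \<ge> 1 / 2" "v \<in> zone \<Longrightarrow> 1 - v \<noteq> 0"
proof -
  assume v: "v \<in> zone"
  have "Re v \<le> 1 / 2" using complex_Re_le_cmod[of v] v by (simp add: zone_iff)
  thus "1 - v \<notin> \<real>\<^sub>\<le>\<^sub>0" by (auto simp: complex_nonpos_Reals_iff)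
  show "norm (1 - v) \<ge> 1 / 2" using norm_triangle_ineq2[of 1 v] v by (simp add: zone_iff)
  thus "1 - v \<noteq> 0" by auto
qed

lemma zone_map_polar:
  assumes "v \<in> zone"
  defines "r \<equiv> exp (- ln (norm (1 - v)) / real k)" and "t \<equiv> (pi + Im (Ln (1 - v))) / real k"
  shows "zone_map v = of_real r * (\<i> * cis (- t))" "1 \<le> r" "r ^ k = 1 / norm (1 - v)" "r ^ k \<le> 2"
    "5 * pi / 6 \<le> real k * t" "real k * t \<le> 7 * pi / 6"
proof -
  note v = zone_one_minus[OF assms(1)]
  have k0: "real k > 0" using k_ge by simp
  show "zone_map v = of_real r * (\<i> * cis (- t))"
  proof -
    have "- (Ln (1 - v) + \<i> * pi) / k = Complex (- ln (norm (1 - v)) / real k) (- t)"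
      using v k0 by (simp add: complex_eq_iff t_def field_simps)
    thus ?thesis unfolding zone_map_def by (simp add: exp_eq_polar r_def)
  qed
  have n: "norm (1 - v) \<le> 1" "norm (1 - v) > 0" using assms(1) v by (auto simp: zone_iff)
  have "ln (norm (1 - v)) \<le> 0" using n by simp
  thus "1 \<le> r" using k0 by (simp add: r_def divide_nonpos_pos)
  have "r ^ k = exp (real k * (- ln (norm (1 - v)) / k))" unfolding r_def by (rule exp_of_nat_mult [symmetric])
  also have "\<dots> = 1 / norm (1 - v)" using k0 n by (simp add: exp_minus field_simps)
  finally show rk: "r ^ k = 1 / norm (1 - v)" .
  show "r ^ k \<le> 2" unfolding rk using v(2) n by (simp add: field_simps)
  have "\<bar>Im (Ln (1 - v))\<bar> \<le> pi / 6" using assms(1) by (intro abs_Im_Ln_le) (simp add: zone_iff)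
  thus "5 * pi / 6 \<le> real k * t" "real k * t \<le> 7 * pi / 6" using k0 by (auto simp: t_def)
qed

lemma zone_map_facts:
  assumes "v \<in> zone"
  shows "0 < Re (zone_map v)" "Re (zone_map v) \<le> 1 / 2" "1 \<le> norm (zone_map v)" 
    "95 / 100 * norm (zone_map v) \<le> Im (zone_map v)" "Im (zone_map v) > 0" "138 / 100 \<le> norm (zone_map v - 1) ^ 2"
proof -
  note p = zone_map_polar[OF assms]
  note f = zone_facts[OF p(1,2,4,5,6)]
  show "0 < Re (zone_map v)" "Re (zone_map v) \<le> 1 / 2" "138 / 100 \<le> norm (zone_map v - 1) ^ 2" by (fact f)+
  show n: "1 \<le> norm (zone_map v)" unfolding f(3) by (fact p)
  have "95 / 100 * norm (zone_map v) \<le> cos ((pi + Im (Ln (1 - v))) / k) * norm (zone_map v)"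
    by (rule mult_right_mono[OF f(5)]) simp
  thus I: "95 / 100 * norm (zone_map v) \<le> Im (zone_map v)" unfolding f(3) f(4) by (simp only: mult.commute)
  show "Im (zone_map v) > 0" using n I by linarith
qed

lemma zone_map_power_k:
  assumes "v \<in> zone"
  shows "1 + 1 / zone_map v ^ k = v"
proof -
  have k0: "of_nat k \<noteq> (0 :: complex)" using k_ge by simp
  have "zone_map v ^ k = exp (of_nat k * (- (Ln (1 - v) + \<i> * pi) / k))"
    unfolding zone_map_def power_mult_distrib by (simp only: exp_of_nat_mult i_power_k mult_1)
  also have "of_nat k * (- (Ln (1 - v) + \<i> * pi) / k) = - Ln (1 - v) - \<i> * pi"
    using k0 by (simp add: field_simps)
  also have "exp \<dots> = - (1 / (1 - v))"
    using zone_one_minus[OF assms] by (simp add: exp_diff exp_minus field_simps)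
  finally show ?thesis using zone_one_minus[OF assms] by simp
qed

lemma zone_map_has_field_derivative:
  assumes "v \<in> zone"
  shows "(zone_map has_field_derivative zone_map v / (of_nat k * (1 - v))) (at v within A)"
  unfolding zone_map_def using zone_one_minus[OF assms] k_ge
  by (auto intro!: derivative_eq_intros simp: field_simps)

text \<open>With \<open>k t\<close> within \<open>pi/6\<close> of \<open>pi\<close>, the argument
  \<open>k t - pi\<close> of \<open>1 - v\<close> lies in the range of the principal logarithm. No
  multiple of \<open>2 pi\<close> is lost, and \<open>zone_map\<close> returns \<open>z\<close>
  itself rather than another \<open>k\<close>-th root.\<close>

lemma zone_map_eq:
  assumes z: "z = of_real r * (\<i> * cis (- t))" and r: "1 \<le> r"
    and t: "5 * pi / 6 \<le> real k * t" "real k * t \<le> 7 * pi / 6" and n: "norm (1 + 1 / z ^ k) \<le> 1 / 2"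
  shows "1 + 1 / z ^ k \<in> zone" "z = zone_map (1 + 1 / z ^ k)"
proof -
  have k0: "real k > 0" using k_ge by simp
  have rk: "r ^ k \<ge> 1" using r by (rule one_le_power)
  have zk: "z ^ k = of_real (r ^ k) * cis (- (real k * t))" unfolding z by (rule polar_power_k)
  have "norm (z ^ k) = r ^ k" using r by (simp add: zk norm_mult norm_power)
  hence "norm (1 - (1 + 1 / z ^ k)) \<le> 1" using rk by (simp add: norm_divide)
  thus "1 + 1 / z ^ k \<in> zone" using n by (simp add: zone_iff)
  have "1 - (1 + 1 / z ^ k) = - (of_real (1 / r ^ k) * cis (real k * t))"
    using r by (simp add: zk field_simps cis_mult flip: cis_inverse) 
  also have "\<dots> = of_real (1 / r ^ k) * cis (real k * t - pi)"
    by (simp add: complex_eq_iff cos_diff sin_diff)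
  also have "\<dots> = exp (Complex (- k * ln r) (real k * t - pi))"
    using r by (simp add: exp_eq_polar exp_minus exp_of_nat_mult field_simps)
  finally have "Ln (1 - (1 + 1 / z ^ k)) = Complex (- k * ln r) (real k * t - pi)"
    by (simp only:) (rule Ln_exp; use t pi_gt_zero in \<open>simp; linarith\<close>)
  hence "zone_map (1 + 1 / z ^ k) = \<i> * exp (- (Complex (- k * ln r) (real k * t - pi) + \<i> * pi) / k)"
    by (simp only: zone_map_def)
  also have "- (Complex (- k * ln r) (real k * t - pi) + \<i> * pi) / k = Complex (ln r) (- t)"
    using k0 by (simp add: complex_eq_iff field_simps)
  also have "\<i> * exp \<dots> = z" using r by (simp add: exp_eq_polar z)
  finally show "z = zone_map (1 + 1 / z ^ k)" by simp
qed

text \<open>The factor \<open>k\<close> from the power cancels the \<open>1/k\<close> in the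
  derivative of \<open>zone_map\<close>. What remains is controlled by
  \<open>|C z| / |C z + D| \<le> |z| / Im z \<le> 100/95\<close>, likewise with \<open>- D\<close>,
  and by \<open>1 / |1 - v| \<le> 2\<close>.\<close>

lemma lattice_term_zone_map_lipschitz:
  assumes "v \<in> zone" "w \<in> zone"
  shows "norm (lattice_term k (zone_map v) x - lattice_term k (zone_map w) x) \<le>
           (2 / (95 / 100) * tail_majorant m (138 / 100) x) * norm (v - w)"
proof -
  obtain c d where x: "x = (c, d)" by (cases x)
  define C D :: complex where "C = of_nat (Suc c)" and "D = of_nat (Suc d)"
  define f where "f = (\<lambda>v. 1 / (C * zone_map v + D) ^ k + 1 / (C * zone_map v - D) ^ k)"
  define f' where "f' = (\<lambda>v. - (C * zone_map v / (1 - v)) * 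
         (1 / (C * zone_map v + D) ^ Suc k + 1 / (C * zone_map v - D) ^ Suc k))"
  have k0: "of_nat k \<noteq> (0 :: complex)" using k_ge by simp
  have "norm (f v - f w) \<le> (2 / (95 / 100) * tail_majorant m (138 / 100) x) * norm (v - w)"
  proof (rule field_differentiable_bound[OF convex_zone _ _ assms])
    fix u assume u: "u \<in> zone"
    note F = zone_map_facts[OF u]
    have C: "norm C > 0" by (simp add: C_def del: of_nat_Suc)
    have I: "norm C * Im (zone_map u) \<le> norm (C * zone_map u + D)" 
            "norm C * Im (zone_map u) \<le> norm (C * zone_map u - D)"
      using abs_Im_le_cmod[of "C * zone_map u + D"] abs_Im_le_cmod[of "C * zone_map u - D"] F(5)
      by (simp_all add: C_def D_def abs_mult del: of_nat_Suc)
    have P: "norm C * Im (zone_map u) > 0" using C F(5) by simp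
    hence nz: "C * zone_map u + D \<noteq> 0" "C * zone_map u - D \<noteq> 0" using I by auto
    have alg: "- (inverse (q * X) * (K * (C * (Z / (K * w))) * X) * inverse (q * X)) = - (C * Z * inverse w) * inverse (q * (q * X))"
      if "q \<noteq> 0" "X \<noteq> 0" "K \<noteq> 0" "w \<noteq> 0" for q X K w Z :: complex
      using that by (simp add: field_simps)
    have 1: "((\<lambda>v. 1 / (C * zone_map v + s * D) ^ k) has_field_derivative
           - (C * zone_map u / (1 - u)) * (1 / (C * zone_map u + s * D) ^ Suc k)) (at u within zone)" 
      if "C * zone_map u + s * D \<noteq> 0" for s
    proof -
      have *: "((\<lambda>v. inverse ((C * zone_map v + s * D) ^ k)) has_field_derivative
              - (inverse ((C * zone_map u + s * D) ^ k) * 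
                 (of_nat k * (C * (zone_map u / (of_nat k * (1 - u)))) * (C * zone_map u + s * D) ^ (k - 1)) * 
                 inverse ((C * zone_map u + s * D) ^ k))) (at u within zone)"
        using that by (auto intro!: derivative_eq_intros zone_map_has_field_derivative[OF u])
      have pw: "(C * zone_map u + s * D) ^ k = (C * zone_map u + s * D) * (C * zone_map u + s * D) ^ (k - 1)"
        using k_ge by (cases k) auto
      show ?thesis
        unfolding divide_inverse mult_1
        by (rule DERIV_cong[OF *], unfold pw power_Suc, rule alg) (use that k0 zone_one_minus(3)[OF u] in auto)
    qed
    show "(f has_field_derivative f' u) (at u within zone)"
      unfolding f_def f'_def using 1[of 1] 1[of "-1"] nz
      by (auto simp: distrib_left intro!: DERIV_add[THEN DERIV_cong])
    have B: "norm C * norm (zone_map u) / norm (1 - u) * (1 / q ^ Suc k) \<le> 2 / (95 / 100) * (1 / q ^ k)"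
      if q: "norm C * Im (zone_map u) \<le> q" for q
    proof -
      have q0: "q > 0" using P q by linarith
      have "norm C * (95 / 100 * norm (zone_map u)) \<le> norm C * Im (zone_map u)"
        by (intro mult_left_mono F(4)) auto
      hence "norm C * norm (zone_map u) * (95 / 100) \<le> q" using q by (simp add: mult_ac)
      hence "norm C * norm (zone_map u) / q \<le> 1 / (95 / 100)"
        using q0 by (simp add: field_simps)
      moreover have "1 / norm (1 - u) \<le> 2"
        using zone_one_minus(2)[OF u] by (simp add: divide_le_eq)
      ultimately have "(norm C * norm (zone_map u) / q) * (1 / norm (1 - u)) \<le> 1 / (95 / 100) * 2"
        using q0 by (intro mult_mono) auto
      hence "((norm C * norm (zone_map u) / q) * (1 / norm (1 - u))) * (1 / q ^ k) \<le> (1 / (95 / 100) * 2) * (1 / q ^ k)"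
        using q0 by (intro mult_right_mono) auto
      thus ?thesis by (simp add: mult_ac)
    qed
    have "norm (f' u) \<le> norm C * norm (zone_map u) / norm (1 - u) * 
        (1 / norm (C * zone_map u + D) ^ Suc k + 1 / norm (C * zone_map u - D) ^ Suc k)"
      unfolding f'_def norm_mult norm_minus_cancel norm_divide
      by (intro mult_left_mono order.trans[OF norm_triangle_ineq]) (auto simp: norm_divide norm_power norm_mult)
    also have "\<dots> \<le> 2 / (95 / 100) * (1 / norm (C * zone_map u + D) ^ k) + 2 / (95 / 100) * (1 / norm (C * zone_map u - D) ^ k)"
      unfolding distrib_left by (intro add_mono B I)
    also have "\<dots> = 2 / (95 / 100) * lattice_norm_term k (zone_map u) x"
      by (simp add: lattice_norm_term_def x C_def D_def)
    also have "lattice_norm_term k (zone_map u) x \<le> tail_majorant m (138 / 100) x"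
      by (rule lattice_norm_term_le_majorant[of _ _ m, unfolded fold_k]) (use F in auto)
    finally show "norm (f' u) \<le> 2 / (95 / 100) * tail_majorant m (138 / 100) x"
      by simp
  qed
  thus ?thesis by (simp add: f_def lattice_term_def x C_def D_def)
qed

lemma eisenstein_rest_zone_map_lipschitz:
  assumes "v \<in> zone" "w \<in> zone"
  shows "norm (eisenstein_rest k (zone_map v) - eisenstein_rest k (zone_map w)) \<le> 1 / 2 * norm (v - w)"
proof -
  let ?B = "(58 / 1000 + 1 / (138 / 100) ^ 6) / (138 / 100) ^ (m - 6) :: real"
  have "norm (eisenstein_rest k (zone_map v) - eisenstein_rest k (zone_map w)) \<le> 
        norm (lattice_tail k (zone_map v) - lattice_tail k (zone_map w))"
    unfolding eisenstein_rest_def diff_divide_distrib [symmetric]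
    using k_ge by (intro norm_divide_zeta_nat_le) auto
  also have "\<dots> \<le> (2 / (95 / 100) * infsum (tail_majorant m (138 / 100)) UNIV) * norm (v - w)"
  proof (rule norm_infsum_le)
    show "((\<lambda>x. lattice_term k (zone_map v) x - lattice_term k (zone_map w) x) has_sum
            lattice_tail k (zone_map v) - lattice_tail k (zone_map w)) UNIV"
      unfolding lattice_tail_def using zone_map_facts[OF assms(1)] zone_map_facts[OF assms(2)] k_ge even_k
      by (intro has_sum_diff has_sum_infsum lattice_term_summable) auto
    show "((\<lambda>x. 2 / (95 / 100) * tail_majorant m (138 / 100) x * norm (v - w)) has_sum 
            2 / (95 / 100) * infsum (tail_majorant m (138 / 100)) UNIV * norm (v - w)) UNIV"
      by (intro has_sum_cmult_left has_sum_cmult_right has_sum_infsum tail_majorant_sum) (use m_ge in auto)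
  qed (rule lattice_term_zone_map_lipschitz[OF assms])
  also have "\<dots> \<le> 1 / 2 * norm (v - w)"
  proof (rule mult_right_mono)
    have "infsum (tail_majorant m (138 / 100)) UNIV \<le> ?B"
      by (rule tail_majorant_sum) (use m_ge in auto)
    also have "\<dots> \<le> (58 / 1000 + 1 / (138 / 100) ^ 6) / 1"
      by (intro divide_left_mono) auto
    \<comment> \<open>\<open>0.058 + 1.38^-6\<close> is about \<open>0.203\<close>, and
      \<open>0.205 * 2 / 0.95 < 0.44\<close>, which leaves room below \<open>1/2\<close>.\<close>
    also have "\<dots> \<le> 205 / 1000" by (simp add: power_numeral_reduce)
    finally show "2 / (95 / 100) * infsum (tail_majorant m (138 / 100)) UNIV \<le> 1 / 2" by simp
  qed auto
  finally show ?thesis .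
qed

lemma eisenstein_zone_map:
  assumes "v \<in> zone"
  shows "eisenstein k (zone_map v) = v + eisenstein_rest k (zone_map v)"
  using eisenstein_eq_rest[OF zone_map_facts(5)[OF assms]] zone_map_power_k[OF assms] by simp

text \<open>In the coordinate \<open>v\<close> the function is the identity plus a map with
  Lipschitz constant \<open>1/2\<close>. The lower bound gives injectivity on \<open>zone\<close>
  and keeps the derivative from vanishing.\<close>

lemma eisenstein_zone_map_expanding:
  assumes "v \<in> zone" "w \<in> zone"
  shows "norm (eisenstein k (zone_map v) - eisenstein k (zone_map w)) \<ge> 1 / 2 * norm (v - w)"
proof -
  have "norm (v - w) - norm (eisenstein_rest k (zone_map v) - eisenstein_rest k (zone_map w)) 
      \<le> norm ((v - w) + (eisenstein_rest k (zone_map v) - eisenstein_rest k (zone_map w)))"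
    by (rule norm_diff_ineq)
  also have "(v - w) + (eisenstein_rest k (zone_map v) - eisenstein_rest k (zone_map w)) = 
               eisenstein k (zone_map v) - eisenstein k (zone_map w)"
    using assms by (simp add: eisenstein_zone_map)
  finally show ?thesis using eisenstein_rest_zone_map_lipschitz[OF assms] by linarith
qed

text \<open>At such a zero \<open>z^-k\<close> is within \<open>1/2\<close> of \<open>-1\<close>, so
  \<open>k t\<close> is within \<open>pi/6\<close> of an odd multiple of \<open>pi\<close>. The
  multiple \<open>pi\<close> itself leads into \<open>zone\<close>; for larger ones the height
  forces \<open>|z|\<close> to be too big.\<close>

lemma zero_in_zone:
  assumes "Im z > 0" "0 \<le> Re z" "Re z \<le> 1 / 2" "1 \<le> norm z" "cos low_angle \<le> Im z" "eisenstein k z = 0"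
  shows "\<exists>v\<in>zone. z = zone_map v"
proof -
  define s where "s = (norm z)\<^sup>2"
  have y2: "(cos low_angle)\<^sup>2 \<le> (Im z)\<^sup>2" using assms cos_low_angle by (intro power_mono) auto
  hence "906 / 1000 \<le> (Im z)\<^sup>2" using cos_low_angle by linarith
  moreover have "(1 / 2)\<^sup>2 \<le> (1 - Re z)\<^sup>2" using assms by (intro power_mono) auto
  hence "1 / 4 \<le> (1 - Re z)\<^sup>2" by (simp add: power_divide)
  moreover have "norm (z - 1) ^ 2 = (1 - Re z)\<^sup>2 + (Im z)\<^sup>2"
    unfolding cmod_power2 by (simp add: power2_commute)
  \<comment> \<open>The bounds \<open>906/1000\<close> for the squared height and \<open>1/4\<close>
    for the squared horizontal distance to \<open>1\<close> add up to this constant.\<close>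
  ultimately have n: "1156 / 1000 \<le> norm (z - 1) ^ 2" by linarith
  have "norm (eisenstein_rest k z) \<le> (58 / 1000 + 1 / (1156 / 1000) ^ 6) / (1156 / 1000) ^ (m - 6)"
    unfolding k_eq by (rule norm_eisenstein_rest_le) (use assms n m_ge in auto)
  also have "\<dots> \<le> (478 / 1000) / (1156 / 1000) ^ (m - 6)"
    by (intro divide_right_mono) (simp_all add: power_numeral_reduce)
  finally have rest: "norm (eisenstein_rest k z) \<le> (478 / 1000) / (1156 / 1000) ^ (m - 6)" .
  have "(478 / 1000) / (1156 / 1000) ^ (m - 6) \<le> (478 / 1000 :: real) / 1"
    by (intro divide_left_mono) auto
  hence rest': "norm (eisenstein_rest k z) \<le> 478 / 1000" using rest by linarith
  have "1 + 1 / z ^ k = - eisenstein_rest k z"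
    using eisenstein_eq_rest[OF assms(1)] assms(6) by (simp add: add_eq_0_iff2)
  hence main: "norm (1 + 1 / z ^ k) = norm (eisenstein_rest k z)" by simp
  obtain t where t: "0 \<le> t" "t < pi / 2" and z: "z = of_real (norm z) * (\<i> * cis (- t))"
    using upper_half_plane_polar[OF assms(1,2)] by metis
  have zk: "z ^ k = of_real (norm z ^ k) * cis (- (real k * t))"
    by (subst z) (rule polar_power_k)
  have "1 / z ^ k = of_real (1 / norm z ^ k) * inverse (cis (- (real k * t)))"
    unfolding zk by (simp add: divide_inverse)
  also have "inverse (cis (- (real k * t))) = cis (real k * t)"
    by (simp only: cis_inverse minus_minus)
  also have "of_real (1 / norm z ^ k) * cis (real k * t) = - (of_real (1 / norm z ^ k) * cis (real k * t - pi))"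
    by (simp add: complex_eq_iff cos_diff sin_diff)
  finally have "norm (1 - of_real (1 / norm z ^ k) * cis (real k * t - pi)) \<le> 1 / 2"
    using main rest' by simp
  moreover have "1 / norm z ^ k > 0" using assms(4) by (intro divide_pos_pos zero_less_power) auto
  ultimately have "cos (real k * t - pi) \<ge> sqrt 3 / 2" by (intro cos_ge_if_near_1)
  hence c: "- cos (real k * t) \<ge> sqrt 3 / 2" by (simp add: cos_diff)
  show ?thesis
  proof (cases "real k * t < 5 * pi / 2")
    case True
    have "5 * pi / 6 \<le> real k * t" "real k * t \<le> 7 * pi / 6"
      using angle_near_pi[OF _ True c] t by auto
    from zone_map_eq[OF z assms(4) this] main rest' show ?thesis by auto
  next
    case False
    txt \<open>Here the height forces \<open>\<bar>z\<bar>\<^sup>k \<ge> 1 + 21/k\<close>, so \<open>\<bar>1 + z\<^sup>-\<^sup>k\<bar>\<close> is at least of order \<open>1/k\<close>,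
      whereas the tail decays exponentially in \<open>k\<close>.\<close>
    define p where "p = 1 / (real m)\<^sup>2"
    define u where "u = 5 * pi / 2 / real k"
    have m0: "real m \<ge> 6" using m_ge by simp
    have ut: "u \<le> t" using False k_ge by (simp add: u_def field_simps)
    have u: "0 \<le> u" "u < pi / 2" using ut t by (auto simp: u_def)
    have "Im z = norm z * cos t" by (subst z) simp
    also have "cos t \<le> cos u" using u ut t by (intro cos_monotone_0_pi_le) auto
    hence "norm z * cos t \<le> norm z * cos u" by (intro mult_left_mono) auto
    finally have "(Im z)\<^sup>2 \<le> (norm z * cos u)\<^sup>2" using assms by (intro power_mono) auto
    \<comment> \<open>A point at an angle of at least \<open>u\<close> has height at most
      \<open>|z| cos u\<close>, and \<open>(cos u)^2 \<le> 1 / (1 + u^2)\<close>; a prescribed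
      height therefore pushes \<open>s = |z|^2\<close> up.\<close>
    hence "(Im z)\<^sup>2 * (1 + u\<^sup>2) \<le> s * ((cos u)\<^sup>2 * (1 + u\<^sup>2))"
      by (simp add: s_def power_mult_distrib mult_right_mono flip: mult.assoc)
    also have "\<dots> \<le> s * 1" using u by (intro mult_left_mono cos_sq_times_le_1) (auto simp: s_def)
    finally have s1: "(Im z)\<^sup>2 * (1 + u\<^sup>2) \<le> s" by simp
    have pi2: "9869 / 1000 \<le> pi\<^sup>2" "pi\<^sup>2 \<le> 9870 / 1000"
    proof -
      have "(31415 / 10000)\<^sup>2 \<le> pi\<^sup>2" "pi\<^sup>2 \<le> (31416 / 10000)\<^sup>2" 
        using pi_approx by (intro power_mono; simp)+
      thus "9869 / 1000 \<le> pi\<^sup>2" "pi\<^sup>2 \<le> 9870 / 1000" by (simp_all add: power2_eq_square)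
    qed
    have p: "0 \<le> p" "p \<le> 1 / 36"
    proof -
      have "6 * 6 \<le> real m * real m" using m0 by (intro mult_mono) auto
      thus "0 \<le> p" "p \<le> 1 / 36" using m0 by (auto simp: p_def power2_eq_square divide_simps)
    qed
    have rk: "real k = 2 * real m" by (subst k_eq) simp
    have u2: "u\<^sup>2 = 25 / 16 * pi\<^sup>2 * p" and l2: "low_angle\<^sup>2 = 49 / 144 * pi\<^sup>2 * p"
      using m0 rk by (simp_all add: u_def low_angle_def p_def power2_eq_square field_simps)
    \<comment> \<open>Here \<open>p = 4 / k^2\<close>; the squared angles are about
      \<open>15.42 p\<close> and \<open>3.36 p\<close>, rounded down and up respectively.\<close>
    have "25 / 16 * pi\<^sup>2 * p \<ge> 154 / 10 * p" "49 / 144 * pi\<^sup>2 * p \<le> 336 / 100 * p"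
      using p pi2 by (intro mult_right_mono; simp)+
    hence "154 / 10 * p \<le> u\<^sup>2" "low_angle\<^sup>2 \<le> 336 / 100 * p" unfolding u2 l2 by linarith+
    moreover have "1 - low_angle\<^sup>2 \<le> (cos low_angle)\<^sup>2"
      by (rule cos_sq_ge) (use low_angle pi_gt_zero in linarith)+
    ultimately have 1: "1 + 154 / 10 * p \<le> 1 + u\<^sup>2" and 2: "1 - 336 / 100 * p \<le> (cos low_angle)\<^sup>2"
      by linarith+
    have "(1 - 336 / 100 * p) * (1 + 154 / 10 * p) \<le> (Im z)\<^sup>2 * (1 + u\<^sup>2)"
      by (intro mult_mono 1) (use 2 y2 p in auto)
    also note s1
    finally have s2: "(1 - 336 / 100 * p) * (1 + 154 / 10 * p) \<le> s" .
    \<comment> \<open>For \<open>p \<le> 1/36\<close> the quadratic term costs less than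
      \<open>1.44 p\<close>, so at least \<open>10.5 p\<close> of the gain \<open>12.04 p\<close>
      survives.\<close>
    have "p * p \<le> 1 / 36 * p" using p by (intro mult_right_mono) auto
    moreover have "(1 - 336 / 100 * p) * (1 + 154 / 10 * p) = 1 + 1204 / 100 * p - 51744 / 1000 * (p * p)"
      by (simp add: field_simps)
    ultimately have "1 + 105 / 10 * p \<le> (1 - 336 / 100 * p) * (1 + 154 / 10 * p)"
      using p by linarith
    with s2 have s3: "1 + 105 / 10 * p \<le> s" by linarith
    have "1 + real m * (105 / 10 * p) \<le> (1 + 105 / 10 * p) ^ m"
      by (rule Bernoulli_inequality) (use p in simp)
    also have "\<dots> \<le> s ^ m" using s3 p by (intro power_mono) auto
    also have "s ^ m = norm z ^ k" by (simp add: s_def k_eq power_mult)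
    finally have nk: "1 + 105 / 10 / real m \<le> norm z ^ k"
      using m0 by (simp add: p_def power2_eq_square)
    have pos: "1 + 105 / 10 / real m > 0" using m0 by (intro add_pos_pos) auto
    have "1 / norm z ^ k \<le> 1 / (1 + 105 / 10 / real m)"
      using nk pos by (intro divide_left_mono mult_pos_pos) linarith+
    also have "\<dots> = 1 - (105 / 10) / (real m + 105 / 10)" using m0 by (simp add: field_simps)
    finally have "1 / norm z ^ k \<le> 1 - (105 / 10) / (real m + 105 / 10)" .
    moreover have "1 - norm (1 / z ^ k) \<le> norm (1 + 1 / z ^ k)"
      by (metis norm_diff_ineq norm_one)
    hence "1 - 1 / norm z ^ k \<le> norm (eisenstein_rest k z)"
      unfolding main by (simp add: norm_divide norm_power)
    moreover define P where "P = (1156 / 1000 :: real) ^ (m - 6)"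
    have P0: "P > 0" by (simp add: P_def)
    ultimately have "(105 / 10) / (real m + 105 / 10) \<le> (478 / 1000) / P"
      using rest unfolding P_def by linarith
    hence "(105 / 10) * P \<le> 478 / 1000 * (real m + 105 / 10)"
      using m0 P0 by (simp add: field_simps)
    \<comment> \<open>A linear lower bound for the exponential suffices: at \<open>m = 6\<close> the
      two sides of the preceding inequality are \<open>10.5\<close> and about \<open>7.9\<close>,
      and the left one grows faster in \<open>m\<close>.\<close>
    moreover have "1 + real (m - 6) * (156 / 1000) \<le> (1 + 156 / 1000) ^ (m - 6)"
      by (rule Bernoulli_inequality) simp
    hence "1 + (real m - 6) * (156 / 1000) \<le> P"
      using m_ge by (simp add: of_nat_diff P_def)
    ultimately have False using m0 by (simp add: field_simps)
    thus ?thesis ..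
  qed
qed

end

subsection \<open>Coefficients of a function with two conjugate simple poles\<close>

text \<open>Divided differences, taken once at each zero with the derivative as the value there,
  remain holomorphic.\<close>

lemma holomorphic_factor_two_zeros:
  assumes f: "f holomorphic_on S" and S: "open S" "a \<in> S" "b \<in> S" and ab: "a \<noteq> b" and "f a = 0" "f b = 0"
  obtains h where "h holomorphic_on S" "\<And>z. z \<in> S \<Longrightarrow> f z = (z - a) * (z - b) * h z"
proof -
  define g where "g = (\<lambda>z. if z = a then deriv f a else (f z - f a) / (z - a))"
  define h where "h = (\<lambda>z. if z = b then deriv g b else (g z - g b) / (z - b))"
  have g: "g holomorphic_on S" unfolding g_def by (rule pole_lemma_open[OF f S(1)])
  have h: "h holomorphic_on S" unfolding h_def by (rule pole_lemma_open[OF g S(1)])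
  have fg: "f z = (z - a) * g z" for z
    using assms by (auto simp: g_def)
  have "g b = 0" using assms by (auto simp: g_def)
  hence "g z = (z - b) * h z" for z by (auto simp: h_def)
  hence "f z = (z - a) * (z - b) * h z" for z using fg[of z] by simp
  with h show ?thesis using that by blast
qed

lemma deriv_factor_at_zero:
  fixes f h :: "complex \<Rightarrow> complex"
  assumes "h holomorphic_on S" "open S" "a \<in> S" "\<And>z. z \<in> S \<Longrightarrow> f z = (z - a) * (z - b) * h z"
  shows "deriv f a = (a - b) * h a"
proof (rule DERIV_imp_deriv)
  have "(h has_field_derivative deriv h a) (at a)" using assms holomorphic_derivI by blast
  hence "((\<lambda>z. (z - a) * (z - b) * h z) has_field_derivative (a - b) * h a) (at a)"
    by (auto intro!: derivative_eq_intros)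
  thus "(f has_field_derivative (a - b) * h a) (at a)"
    by (rule has_field_derivative_transform_within_open[OF _ assms(2,3)]) (simp add: assms(4))
qed

text \<open>The zeros in an intermediate closed disc form a compact set; if there are any, one of
  least modulus supplies \<open>\<rho>\<close>.\<close>

lemma no_zeros_on_larger_disc:
  fixes h :: "complex \<Rightarrow> complex"
  assumes h: "h holomorphic_on ball 0 R" and "0 \<le> r" "r < R" and nz: "\<And>z. norm z \<le> r \<Longrightarrow> h z \<noteq> 0"
  obtains \<rho> where "r < \<rho>" "\<rho> < R" "\<And>z. norm z < \<rho> \<Longrightarrow> h z \<noteq> 0"
proof -
  obtain R' where R': "r < R'" "R' < R" using dense[OF assms(3)] by blast
  define Z where "Z = {z \<in> cball 0 R'. h z = 0}"
  have cont: "continuous_on (cball 0 R') h"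
    by (rule holomorphic_on_imp_continuous_on[OF holomorphic_on_subset[OF h]]) (use R' in auto)
  have "closed Z" unfolding Z_def
    by (rule continuous_closed_preimage_constant[OF cont]) auto
  moreover have "bounded Z" by (rule bounded_subset[of "cball 0 R'"]) (auto simp: Z_def)
  ultimately have "compact Z" by (simp add: compact_eq_bounded_closed)
  show ?thesis
  proof (cases "Z = {}")
    case True
    thus ?thesis using R' by (intro that[of R']) (auto simp: Z_def)
  next
    case False
    obtain z0 where z0: "z0 \<in> Z" "\<And>z. z \<in> Z \<Longrightarrow> norm z0 \<le> norm z"
      using continuous_attains_inf[OF \<open>compact Z\<close> False, of norm] by (auto intro: continuous_intros)
    have "norm z0 > r" using z0(1) nz[of z0] by (force simp: Z_def)
    moreover have "norm z0 \<le> R'" using z0(1) by (simp add: Z_def)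
    moreover have "h z \<noteq> 0" if "norm z < norm z0" for z
      using z0(2)[of z] that calculation by (auto simp: Z_def)
    ultimately show ?thesis using R' by (intro that[of "norm z0"]) auto
  qed
qed

lemma has_fps_expansion_simple_pole:
  assumes "q \<noteq> (0 :: complex)"
  shows "(\<lambda>z. 1 / (z - q)) has_fps_expansion Abs_fps (\<lambda>n. - (1 / q ^ Suc n))"
proof (rule has_fps_expansionI)
  have "eventually (\<lambda>z. z \<in> ball 0 (norm q)) (nhds (0 :: complex))"
    using assms by (intro eventually_nhds_in_open) auto
  thus "eventually (\<lambda>z. (\<lambda>n. fps_nth (Abs_fps (\<lambda>n. - (1 / q ^ Suc n))) n * z ^ n) sums (1 / (z - q))) (nhds 0)"
  proof eventually_elim
    case (elim z)
    hence "norm (z / q) < 1" using assms by (simp add: norm_divide)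
    hence "(\<lambda>n. - (1 / q) * (z / q) ^ n) sums (- (1 / q) * (1 / (1 - z / q)))"
      by (intro sums_mult geometric_sums)
    moreover have "z \<noteq> q" using elim by auto
    hence "- (1 / q) * (1 / (1 - z / q)) = 1 / (z - q)"
      using assms by (simp add: divide_simps)
    ultimately show ?case by (simp add: power_divide mult.commute)
  qed
qed

text \<open>The residues at conjugate poles are conjugate, so the two principal parts contribute
  \<open>Re (- (2 \<alpha> / q0) / q0^n)\<close> to the \<open>n\<close>-th coefficient, a cosine
  with amplitude \<open>|2 \<alpha> / q0|\<close> after scaling. The remaining series converges at
  \<open>|q0|\<close>, hence its scaled coefficients tend to zero.\<close>

theorem recip_coeff_conjugate_pole_asymptotics:
  fixes F :: "real fps" and f :: "complex \<Rightarrow> complex" and q0 :: complex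
  assumes f: "f holomorphic_on ball 0 1" and exp: "f has_fps_expansion Abs_fps (\<lambda>n. of_real (fps_nth F n))"
    and real: "\<And>z. norm z < 1 \<Longrightarrow> f (cnj z) = cnj (f z)"
    and F0: "fps_nth F 0 \<noteq> 0"
    and q0: "norm q0 < 1" "Im q0 \<noteq> 0" "f q0 = 0" "deriv f q0 \<noteq> 0"
    and zeros: "\<And>z. norm z \<le> norm q0 \<Longrightarrow> f z = 0 \<Longrightarrow> z = q0 \<or> z = cnj q0"
  obtains A \<phi> where "A > 0" 
    "(\<lambda>n. fps_nth (inverse F) n * norm q0 ^ n - A * cos (real n * Arg q0 + \<phi>)) \<longlonglongrightarrow> 0"
proof -
  define q1 where "q1 = cnj q0"
  have ne: "q0 \<noteq> q1" "q0 \<noteq> 0" "q1 \<noteq> 0" and n1: "norm q1 = norm q0"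
    using q0(2) by (auto simp: q1_def complex_eq_iff)
  have mem: "q0 \<in> ball 0 1" "q1 \<in> ball 0 1" using q0 n1 by auto
  have fq1: "f q1 = 0" using real[of q0] q0 by (simp add: q1_def)
  obtain h where h: "h holomorphic_on ball 0 1" "\<And>z. z \<in> ball 0 1 \<Longrightarrow> f z = (z - q0) * (z - q1) * h z"
    using holomorphic_factor_two_zeros[OF f open_ball mem ne(1) q0(3) fq1] by metis
  have d0: "deriv f q0 = (q0 - q1) * h q0"
    by (rule deriv_factor_at_zero[OF h(1) open_ball mem(1) h(2)])
  have d1: "deriv f q1 = (q1 - q0) * h q1"
    by (rule deriv_factor_at_zero[OF h(1) open_ball mem(2)]) (use h(2) in auto)
  have dc: "deriv f q1 = cnj (deriv f q0)"
  proof (rule DERIV_imp_deriv)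
    have "(f has_field_derivative deriv f q0) (at q0)" using f mem holomorphic_derivI by blast
    hence "((cnj \<circ> f \<circ> cnj) has_field_derivative cnj (deriv f q0)) (at q1)"
      using has_field_derivative_cnj_cnj[of f "deriv f q0" q1] by (simp add: q1_def)
    thus "(f has_field_derivative cnj (deriv f q0)) (at q1)"
      by (rule has_field_derivative_transform_within_open[of _ _ _ "ball 0 1"]) (use mem real in auto)
  qed
  have hz: "h q0 \<noteq> 0" "h q1 \<noteq> 0" using d0 d1 dc q0(4) by auto
  obtain \<rho> where \<rho>: "norm q0 < \<rho>" "\<rho> < 1" "\<And>z. norm z < \<rho> \<Longrightarrow> h z \<noteq> 0"
  proof (rule no_zeros_on_larger_disc[OF h(1), of "norm q0"])
    fix z :: complex assume z: "norm z \<le> norm q0"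
    show "h z \<noteq> 0"
    proof
      assume "h z = 0"
      hence "f z = 0" using h(2)[of z] z q0 by simp
      with zeros[OF z] hz \<open>h z = 0\<close> show False by (auto simp: q1_def)
    qed
  qed (use q0 in auto)
  define \<alpha> where "\<alpha> = 1 / deriv f q0"
  have \<alpha>: "\<alpha> \<noteq> 0" "cnj \<alpha> = 1 / deriv f q1" using q0 dc by (auto simp: \<alpha>_def)
  \<comment> \<open>Divided by \<open>(z - q0)(z - q1)\<close>, this is \<open>1/f\<close> minus
    both principal parts. Its zeros at \<open>q0\<close> and \<open>q1\<close> make the quotient
    \<open>e\<close> holomorphic on the larger disc.\<close>
  define w where "w = (\<lambda>z. 1 / h z - \<alpha> * (z - q1) - cnj \<alpha> * (z - q0))"
  have w: "w holomorphic_on ball 0 \<rho>" unfolding w_def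
    by (intro holomorphic_intros holomorphic_on_subset[OF h(1)]) (use \<rho> in auto)
  have "w q0 = 0" "w q1 = 0"
    using hz ne q0(4) unfolding w_def \<alpha>(2) unfolding \<alpha>_def d0 d1 by (simp_all add: field_simps)
  with holomorphic_factor_two_zeros[OF w open_ball _ _ ne(1)] \<rho>(1) n1 obtain e 
    where e: "e holomorphic_on ball 0 \<rho>" "\<And>z. z \<in> ball 0 \<rho> \<Longrightarrow> w z = (z - q0) * (z - q1) * e z"
    by (metis mem_ball_0)
  define W where "W = fps_expansion e 0"
  have W: "e has_fps_expansion W"
    unfolding W_def by (rule has_fps_expansion_fps_expansion[OF open_ball _ e(1)]) (use \<rho>(1) norm_ge_zero[of q0] in \<open>simp del: norm_ge_zero\<close>)
  have radius: "fps_conv_radius W \<ge> \<rho>"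
    by (rule holomorphic_on_imp_fps_conv_radius_ge[OF W]) (use e(1) in simp)
  define P where "P = (\<lambda>q. Abs_fps (\<lambda>n. - (1 / q ^ Suc n)) :: complex fps)"
  have exp': "(\<lambda>z. \<alpha> * (1 / (z - q0)) + cnj \<alpha> * (1 / (z - q1)) + e z) has_fps_expansion
          fps_const \<alpha> * P q0 + fps_const (cnj \<alpha>) * P q1 + W"
    unfolding P_def by (intro fps_expansion_intros has_fps_expansion_simple_pole W ne)
  have ev: "eventually (\<lambda>z. \<alpha> * (1 / (z - q0)) + cnj \<alpha> * (1 / (z - q1)) + e z = inverse (f z)) (nhds 0)"
  proof -
    have "eventually (\<lambda>z. z \<in> ball 0 (norm q0)) (nhds (0 :: complex))"
      using ne by (intro eventually_nhds_in_open) auto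
    thus ?thesis
    proof eventually_elim
      case (elim z)
      have z: "z - q0 \<noteq> 0" "z - q1 \<noteq> 0" "h z \<noteq> 0" using elim n1 \<rho> by auto
      have "e z = w z / ((z - q0) * (z - q1))" using e(2)[of z] z elim \<rho> by auto
      moreover have "f z = (z - q0) * (z - q1) * h z" using h(2)[of z] elim q0 by auto
      ultimately show ?case unfolding w_def using z
        by (simp add: divide_simps) (simp add: algebra_simps)
    qed
  qed
  have "(\<lambda>z. inverse (f z)) has_fps_expansion fps_const \<alpha> * P q0 + fps_const (cnj \<alpha>) * P q1 + W"
    by (rule has_fps_expansion_cong[THEN iffD1, OF ev refl exp'])
  moreover have "(\<lambda>z. inverse (f z)) has_fps_expansion inverse (Abs_fps (\<lambda>n. of_real (fps_nth F n)))"
    using F0 by (intro has_fps_expansion_inverse exp) auto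
  moreover have "inverse (Abs_fps (\<lambda>n. of_real (fps_nth F n))) = Abs_fps (\<lambda>n. complex_of_real (fps_nth (inverse F) n))"
  proof (rule fps_inverse_unique)
    have "F * inverse F = 1" using F0 by (simp add: inverse_mult_eq_1')
    hence 1: "fps_nth (F * inverse F) n = (if n = 0 then 1 else 0)" for n by simp
    show "Abs_fps (\<lambda>n. complex_of_real (fps_nth F n)) * Abs_fps (\<lambda>n. complex_of_real (fps_nth (inverse F) n)) = 1"
    proof (rule fps_ext)
      fix n
      have "fps_nth (Abs_fps (\<lambda>n. complex_of_real (fps_nth F n)) * Abs_fps (\<lambda>n. complex_of_real (fps_nth (inverse F) n))) n = 
              of_real (fps_nth (F * inverse F) n)"
        by (simp add: fps_mult_nth)
      thus "fps_nth (Abs_fps (\<lambda>n. complex_of_real (fps_nth F n)) * Abs_fps (\<lambda>n. complex_of_real (fps_nth (inverse F) n))) n = fps_nth 1 n"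
        unfolding 1 by simp
    qed
  qed
  ultimately have eq: "Abs_fps (\<lambda>n. complex_of_real (fps_nth (inverse F) n)) = fps_const \<alpha> * P q0 + fps_const (cnj \<alpha>) * P q1 + W"
    using fps_expansion_unique_complex by metis
  define r where "r = norm q0"
  have r: "r > 0" using ne by (simp add: r_def)
  define A where "A = norm (2 * \<alpha> / q0)"
  define \<psi> where "\<psi> = Arg (- (2 * \<alpha> / q0))"
  have A: "A > 0" using \<alpha> ne by (simp add: A_def)
  have pol: "- (2 * \<alpha> / q0) = of_real A * cis \<psi>" 
    using rcis_cmod_Arg[of "- (2 * \<alpha> / q0)"] by (simp add: A_def \<psi>_def rcis_def norm_minus_cancel)
  have q0pol: "q0 = of_real r * cis (Arg q0)"
    using rcis_cmod_Arg[of q0] by (simp add: rcis_def r_def)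
  have b: "fps_nth (inverse F) n * r ^ n - A * cos (real n * Arg q0 + (- \<psi>)) = Re (fps_nth W n * of_real r ^ n)" for n
  proof -
    define X where "X = \<alpha> / q0 ^ Suc n"
    have "complex_of_real (fps_nth (inverse F) n) = fps_nth (Abs_fps (\<lambda>n. complex_of_real (fps_nth (inverse F) n))) n" by simp
    also have "\<dots> = - X + cnj (- X) + fps_nth W n"
      unfolding eq by (simp add: P_def q1_def X_def)
    finally have "Re (complex_of_real (fps_nth (inverse F) n)) = Re (- X + cnj (- X) + fps_nth W n)"
      by (rule arg_cong)
    hence "fps_nth (inverse F) n = Re (- (2 * X) + fps_nth W n)" by simp
    also have "- (2 * X) = - (2 * \<alpha> / q0) / q0 ^ n" by (simp add: X_def)
    finally have "fps_nth (inverse F) n = Re (- (2 * \<alpha> / q0) / q0 ^ n + fps_nth W n)" .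
    hence "fps_nth (inverse F) n * r ^ n = Re ((- (2 * \<alpha> / q0) / q0 ^ n + fps_nth W n) * of_real (r ^ n))"
      by (simp del: of_real_power)
    also have "(- (2 * \<alpha> / q0) / q0 ^ n + fps_nth W n) * of_real (r ^ n) = of_real A * cis \<psi> / cis (Arg q0) ^ n + fps_nth W n * of_real r ^ n"
    proof -
      have "q0 ^ n = of_real (r ^ n) * cis (Arg q0) ^ n" by (subst q0pol) (simp add: power_mult_distrib)
      thus ?thesis unfolding pol using r by (simp add: divide_simps)
    qed
    also have "of_real A * cis \<psi> / cis (Arg q0) ^ n = of_real A * cis (\<psi> - real n * Arg q0)"
      by (simp add: Complex.DeMoivre cis_divide flip: times_divide_eq_right)
    finally show ?thesis by (simp add: cos_diff algebra_simps)
  qed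
  have "ereal (norm (complex_of_real r)) < fps_conv_radius W"
    by (rule less_le_trans[OF _ radius]) (use \<rho>(1) r in \<open>simp add: r_def\<close>)
  from summable_LIMSEQ_zero[OF summable_fps[OF this]]
  have "(\<lambda>n. Re (fps_nth W n * of_real r ^ n)) \<longlonglongrightarrow> Re 0" by (rule tendsto_Re)
  hence "(\<lambda>n. fps_nth (inverse F) n * norm q0 ^ n - A * cos (real n * Arg q0 + (- \<psi>))) \<longlonglongrightarrow> 0"
    unfolding b[symmetric] by (simp add: r_def)
  with A show ?thesis using that by blast
qed

subsection \<open>Sign changes of perturbed cosine sequences\<close>

lemma num_sign_changes_snoc:
  "num_sign_changes (xs @ [y]) = num_sign_changes xs +
     (if y \<noteq> 0 \<and> filter (\<lambda>x. x \<noteq> 0) xs \<noteq> [] \<and> sgn (last (filter (\<lambda>x. x \<noteq> 0) xs)) \<noteq> sgn y then 1 else 0)"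
proof -
  define ys where "ys = filter (\<lambda>x. x \<noteq> 0) xs"
  define A where "A = (\<lambda>ys :: real list. {i. Suc i < length ys \<and> sgn (ys ! i) \<noteq> sgn (ys ! Suc i)})"
  have nsc: "num_sign_changes zs = card (A (filter (\<lambda>x. x \<noteq> 0) zs))" for zs
    by (simp add: num_sign_changes_def A_def Let_def)
  have fin: "finite (A ys)"
    by (rule finite_subset[of _ "{..<length ys}"]) (auto simp: A_def)
  show ?thesis
  proof (cases "y = 0")
    case False
    have "A (ys @ [y]) = A ys \<union> (if ys \<noteq> [] \<and> sgn (last ys) \<noteq> sgn y then {length ys - 1} else {})"
    proof (rule set_eqI)
      fix i
      consider "Suc i < length ys" | "Suc i = length ys" | "Suc i > length ys" by linarith
      thus "i \<in> A (ys @ [y]) \<longleftrightarrow> i \<in> A ys \<union> (if ys \<noteq> [] \<and> sgn (last ys) \<noteq> sgn y then {length ys - 1} else {})"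
      proof cases
        case 2
        hence "ys \<noteq> []" "i = length ys - 1" by auto
        thus ?thesis using 2 by (auto simp: A_def nth_append last_conv_nth)
      qed (auto simp: A_def nth_append)
    qed
    moreover have "length ys - 1 \<notin> A ys" by (auto simp: A_def)
    ultimately have "card (A (ys @ [y])) = card (A ys) + (if ys \<noteq> [] \<and> sgn (last ys) \<noteq> sgn y then 1 else 0)"
      using fin by auto
    thus ?thesis using False by (simp add: nsc ys_def)
  qed (simp add: nsc)
qed

text \<open>\<open>c n\<close> plays the role of the cosine of an increasing angle and \<open>j n\<close> counts the half turns of
  that angle, so that the number of sign changes of \<open>f\<close> differs from \<open>j\<close> by a bounded amount.\<close>

locale oscillating =
  fixes f c :: "nat \<Rightarrow> real" and j :: "nat \<Rightarrow> int" and \<delta> :: real and N :: nat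
  assumes delta: "\<delta> > 0"
    and sgn_c: "\<And>n. c n \<noteq> 0 \<Longrightarrow> sgn (c n) = (if even (j n) then 1 else -1)"
    and j_step: "\<And>n. j n \<le> j (Suc n) \<and> j (Suc n) \<le> j n + 1"
    and small: "\<And>n. \<bar>c (Suc n)\<bar> < \<delta> \<Longrightarrow> \<bar>c n\<bar> \<ge> \<delta> \<and> \<bar>c (Suc (Suc n))\<bar> \<ge> \<delta> \<and> c n * c (Suc (Suc n)) < 0"
    and sgn_f: "\<And>n. n \<ge> N \<Longrightarrow> \<bar>c n\<bar> \<ge> \<delta> \<Longrightarrow> sgn (f n) = sgn (c n)"
begin

definition V :: "nat \<Rightarrow> nat" where "V n = num_sign_changes (map f [0..<Suc n])"
definition nz :: "nat \<Rightarrow> real list" where "nz n = filter (\<lambda>x. x \<noteq> 0) (map f [0..<Suc n])"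

lemma nz_Suc: "nz (Suc n) = nz n @ (if f (Suc n) \<noteq> 0 then [f (Suc n)] else [])"
  by (simp add: nz_def)

lemma V_Suc: "V (Suc n) = V n + (if f (Suc n) \<noteq> 0 \<and> nz n \<noteq> [] \<and> sgn (last (nz n)) \<noteq> sgn (f (Suc n)) then 1 else 0)"
  using num_sign_changes_snoc[of "map f [0..<Suc n]" "f (Suc n)"]
  by (simp add: V_def nz_def)

lemma nz_big: 
  assumes "n \<ge> N" "\<bar>c n\<bar> \<ge> \<delta>"
  shows "nz n \<noteq> []" "sgn (last (nz n)) = sgn (f n)" "sgn (f n) = (if even (j n) then 1 else -1)" "f n \<noteq> 0"
proof -
  have "c n \<noteq> 0" using assms delta by auto
  thus 1: "sgn (f n) = (if even (j n) then 1 else -1)" using sgn_f[OF assms] sgn_c by simp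
  thus 2: "f n \<noteq> 0" by (auto split: if_splits)
  thus "nz n \<noteq> []" "sgn (last (nz n)) = sgn (f n)"
    by (auto simp: nz_def)
qed

text \<open>Indices with small \<open>c\<close> are isolated, so the previous large index is one or
  two steps back; hence strong induction. Over one step parity decides. Over two steps the outer
  signs are opposite, which leaves exactly one change whatever the middle value is.\<close>

lemma V_eq:
  assumes "\<bar>c M\<bar> \<ge> \<delta>" "M \<ge> N" "n \<ge> M" "\<bar>c n\<bar> \<ge> \<delta>"
  shows "int (V n) - j n = int (V M) - j M"
  using assms(3,4)
proof (induction n rule: less_induct)
  case (less n)
  show ?case
  proof (cases "n = M")
    case False
    then obtain m where m: "n = Suc m" "m \<ge> M" using less.prems by (cases n) auto
    have n: "n \<ge> N" using m assms by simp
    note big = nz_big[OF n less.prems(2)]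
    show ?thesis
    proof (cases "\<bar>c m\<bar> \<ge> \<delta>")
      case True
      have m': "m \<ge> N" using m assms by simp
      note bigm = nz_big[OF m' True]
      have "int (V m) - j m = int (V M) - j M" using less.IH[of m] m True by simp
      moreover have "int (V n) - int (V m) = (if even (j n) = even (j m) then 0 else 1)"
        using big bigm by (simp add: V_Suc m(1))
      moreover have "j n = j m \<or> j n = j m + 1" using j_step[of m] m(1) by auto
      ultimately show ?thesis by auto
    next
      case False
      hence "m \<noteq> M" using assms by auto
      then obtain l where l: "m = Suc l" "l \<ge> M" using m by (cases m) auto
      have l': "l \<ge> N" using l assms by simp
      have sm: "\<bar>c l\<bar> \<ge> \<delta>" "c l * c n < 0" using small[of l] False l m by auto
      note bigl = nz_big[OF l' sm(1)]
      have "int (V l) - j l = int (V M) - j M" using less.IH[of l] l m sm by simp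
      have cz: "c l \<noteq> 0" "c n \<noteq> 0" using sm(2) by auto
      have "sgn (c l) \<noteq> sgn (c n)" using sm(2)
        by (metis mult_less_0_iff not_less_iff_gr_or_eq sgn_1_neg sgn_1_pos sgn_neg sgn_pos)
      hence par: "even (j l) \<noteq> even (j n)" using sgn_c[OF cz(1)] sgn_c[OF cz(2)] by (auto split: if_splits)
      \<comment> \<open>Two steps raise \<open>j\<close> by at most two, and its parity
        changes.\<close>
      have "j n = j l + 1"
        using par j_step[of l] j_step[of m] unfolding m(1) l(1) by presburger
      moreover have "V n = V l + 1"
      proof -
        have s: "sgn (f l) \<noteq> sgn (f n)" using par unfolding big(3) bigl(3) by auto
        show ?thesis
        proof (cases "f m = 0")
          case True
          hence "nz m = nz l" "V m = V l" by (auto simp: l(1) nz_Suc V_Suc)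
          thus ?thesis using s big bigl by (simp add: V_Suc m(1))
        next
          case False
          have Vm: "V m = V l + (if sgn (f l) \<noteq> sgn (f m) then 1 else 0)"
            using False bigl by (simp add: V_Suc l(1))
          have "nz m \<noteq> []" "last (nz m) = f m" using False by (auto simp: l(1) nz_Suc)
          hence Vn: "V n = V m + (if sgn (f m) \<noteq> sgn (f n) then 1 else 0)"
            using big(4) by (simp add: V_Suc m(1))
          have "sgn (f m) = 1 \<or> sgn (f m) = -1" using False by (auto simp: sgn_if)
          moreover have "sgn (f n) = 1 \<or> sgn (f n) = -1" using big(3) by auto
          moreover have "sgn (f l) = 1 \<or> sgn (f l) = -1" using bigl(3) by auto
          ultimately show ?thesis using s Vm Vn by auto
        qed
      qed
      ultimately show ?thesis using \<open>int (V l) - j l = int (V M) - j M\<close> by simp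
    qed
  qed simp
qed

lemma big_exists: obtains M where "M \<ge> N" "\<bar>c M\<bar> \<ge> \<delta>"
  using small[of N] by (metis le_Suc_eq not_le order_refl)

text \<open>A small index directly follows a large one, and over that step both counts rise by at
  most one.\<close>

lemma V_bounded: "\<exists>C M. \<forall>n\<ge>M. \<bar>real (V n) - of_int (j n)\<bar> \<le> C"
proof -
  obtain M where M: "M \<ge> N" "\<bar>c M\<bar> \<ge> \<delta>" by (rule big_exists)
  define C where "C = \<bar>int (V M) - j M\<bar> + 1"
  have "\<bar>int (V n) - j n\<bar> \<le> C" if nM: "n \<ge> M" for n
  proof (cases "\<bar>c n\<bar> \<ge> \<delta>")
    case True
    thus ?thesis using V_eq[OF M(2,1) nM] by (simp add: C_def)
  next
    case False
    hence "n \<noteq> M" using M by auto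
    then obtain m where m: "n = Suc m" "m \<ge> M" using nM by (cases n) auto
    have "\<bar>c m\<bar> \<ge> \<delta>" using small[of m] False m by auto
    hence "int (V m) - j m = int (V M) - j M" using V_eq[OF M(2,1) m(2)] by simp
    moreover have "V n = V m \<or> V n = V m + 1" by (simp add: m V_Suc)
    moreover have "j n = j m \<or> j n = j m + 1" using j_step[of m] m by auto
    ultimately show ?thesis by (auto simp: C_def)
  qed
  hence "\<forall>n\<ge>M. \<bar>real (V n) - of_int (j n)\<bar> \<le> of_int C"
    by (metis of_int_abs of_int_diff of_int_le_iff of_int_of_nat_eq)
  thus ?thesis by blast
qed

lemma card_nonzero_ge: "card {m. m < N + 2 * i \<and> f m \<noteq> 0} \<ge> i"
proof (induction i)
  case (Suc i)
  let ?n = "N + 2 * i"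
  have "f ?n \<noteq> 0 \<or> f (Suc ?n) \<noteq> 0"
  proof (cases "\<bar>c ?n\<bar> \<ge> \<delta>")
    case True
    thus ?thesis using nz_big(4)[of ?n] by simp
  next
    case False
    hence "\<bar>c (Suc ?n)\<bar> \<ge> \<delta>" using small[of ?n] by force
    thus ?thesis using nz_big(4)[of "Suc ?n"] by simp
  qed
  then obtain m where m: "m = ?n \<or> m = Suc ?n" "f m \<noteq> 0" by blast
  have "Suc i \<le> Suc (card {m. m < ?n \<and> f m \<noteq> 0})" using Suc by simp
  also have "\<dots> = card (insert m {m. m < ?n \<and> f m \<noteq> 0})"
    using m by (subst card_insert_disjoint) auto
  also have "\<dots> \<le> card {m. m < N + 2 * Suc i \<and> f m \<noteq> 0}"
    using m by (intro card_mono) auto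
  finally show ?case .
qed simp

text \<open>Each pair of consecutive indices past \<open>N\<close> contains a nonzero value; the
  extra \<open>1\<close> in \<open>(n - N - 1) / 2\<close> pays for an unpaired last index.\<close>

lemma limsup_nonzero_ratio: "limsup (\<lambda>n. ereal (real n / real (card {m. m < n \<and> f m \<noteq> 0}))) \<le> 2"
proof -
  have ev: "eventually (\<lambda>n. real n / real (card {m. m < n \<and> f m \<noteq> 0}) \<le> real n / ((real n - real N - 1) / 2)) sequentially"
    using eventually_gt_at_top[of "N + 1"]
  proof eventually_elim
    case (elim n)
    have "(n - N) div 2 \<le> card {m. m < N + 2 * ((n - N) div 2) \<and> f m \<noteq> 0}" by (rule card_nonzero_ge)
    also have "\<dots> \<le> card {m. m < n \<and> f m \<noteq> 0}"
      using elim by (intro card_mono) auto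
    finally have "real ((n - N) div 2) \<le> real (card {m. m < n \<and> f m \<noteq> 0})" by simp
    moreover have "n \<le> N + 2 * ((n - N) div 2) + 1"
      using elim by presburger
    hence "real n \<le> real (N + 2 * ((n - N) div 2) + 1)" by (subst of_nat_le_iff)
    hence "(real n - real N - 1) / 2 \<le> real ((n - N) div 2)" by simp
    ultimately show ?case using elim by (intro divide_left_mono mult_pos_pos) auto
  qed
  have "(\<lambda>n. 2 / (1 - (real N + 1) / real n)) \<longlonglongrightarrow> 2 / (1 - 0)"
    by (intro tendsto_intros lim_const_over_n) auto
  moreover have "eventually (\<lambda>n. 2 / (1 - (real N + 1) / real n) = real n / ((real n - real N - 1) / 2)) sequentially"
    using eventually_gt_at_top[of "N + 1"] by eventually_elim (simp add: field_simps)
  ultimately have "(\<lambda>n. real n / ((real n - real N - 1) / 2)) \<longlonglongrightarrow> 2"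
    by (simp add: filterlim_cong)
  hence lim: "limsup (\<lambda>n. ereal (real n / ((real n - real N - 1) / 2))) = 2"
    by (intro lim_imp_Limsup) auto
  have "limsup (\<lambda>n. ereal (real n / real (card {m. m < n \<and> f m \<noteq> 0}))) 
      \<le> limsup (\<lambda>n. ereal (real n / ((real n - real N - 1) / 2)))"
    by (intro Limsup_mono) (use ev in auto)
  thus ?thesis unfolding lim .
qed

end

text \<open>A small cosine forces \<open>|sin a| \<ge> 3/4\<close>, so with
  \<open>\<delta> = sin h / 4\<close> the term \<open>sin a * sin h\<close> has size at least
  \<open>3 \<delta>\<close> and dominates \<open>cos a * cos h\<close>, of size below
  \<open>\<delta>\<close>. It enters the two neighbours with opposite signs, and their product is a
  difference of squares.\<close>

lemma cos_neighbours:
  fixes h a \<delta> :: real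
  assumes "0 < h" "h < pi" "\<delta> = sin h / 4" "\<bar>cos a\<bar> < \<delta>"
  shows "\<bar>cos (a - h)\<bar> \<ge> \<delta>" "\<bar>cos (a + h)\<bar> \<ge> \<delta>" "cos (a - h) * cos (a + h) < 0"
proof -
  have h: "sin h > 0" using assms by (simp add: sin_gt_zero)
  have d: "\<delta> > 0" "\<delta> \<le> 1 / 4" using h assms by auto
  have "1 = (sin a)\<^sup>2 + (cos a)\<^sup>2" by simp
  also have "\<dots> = \<bar>sin a\<bar> * \<bar>sin a\<bar> + \<bar>cos a\<bar> * \<bar>cos a\<bar>"
    by (simp add: power2_eq_square)
  also have "\<dots> \<le> \<bar>sin a\<bar> + \<bar>cos a\<bar>"
    by (intro add_mono mult_left_le) auto
  finally have "\<bar>sin a\<bar> \<ge> 3 / 4" using d assms by linarith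
  hence "3 / 4 * sin h \<le> \<bar>sin a\<bar> * sin h" using h by (intro mult_right_mono) auto
  moreover have "3 / 4 * sin h = 3 * \<delta>" using assms by simp
  moreover have "\<bar>sin a * sin h\<bar> = \<bar>sin a\<bar> * sin h" using h by (simp add: abs_mult)
  ultimately have s: "\<bar>sin a * sin h\<bar> \<ge> 3 * \<delta>" by linarith
  have "\<bar>cos a * cos h\<bar> \<le> \<bar>cos a\<bar> * 1" unfolding abs_mult by (intro mult_left_mono) auto
  hence c: "\<bar>cos a * cos h\<bar> < \<delta>" using assms by simp
  show "\<bar>cos (a - h)\<bar> \<ge> \<delta>" "\<bar>cos (a + h)\<bar> \<ge> \<delta>"
    unfolding cos_diff cos_add using s c d by linarith+
  have "cos (a - h) * cos (a + h) = (cos a * cos h)\<^sup>2 - (sin a * sin h)\<^sup>2"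
    unfolding cos_diff cos_add by (simp add: algebra_simps power2_eq_square)
  also have "\<bar>cos a * cos h\<bar>\<^sup>2 < \<bar>sin a * sin h\<bar>\<^sup>2"
    using s c d by (intro power_strict_mono) auto
  hence "(cos a * cos h)\<^sup>2 - (sin a * sin h)\<^sup>2 < 0" by simp
  finally show "cos (a - h) * cos (a + h) < 0" by simp
qed

text \<open>The floor is the index of the multiple of \<open>pi\<close> nearest to \<open>a\<close>.
  Subtracting that multiple leaves an angle in \<open>[-pi/2, pi/2)\<close>, where the cosine is
  nonnegative.\<close>

lemma sgn_cos_floor:
  fixes a :: real
  assumes "cos a \<noteq> 0"
  shows "sgn (cos a) = (if even \<lfloor>a / pi + 1 / 2\<rfloor> then 1 else -1)"
proof -
  define m where "m = \<lfloor>a / pi + 1 / 2\<rfloor>"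
  define b where "b = a - of_int m * pi"
  have "of_int m \<le> a / pi + 1 / 2" "a / pi + 1 / 2 < of_int m + 1" unfolding m_def by linarith+
  hence "- (1 / 2) \<le> a / pi - of_int m" "a / pi - of_int m < 1 / 2" by linarith+
  hence "- (1 / 2) * pi \<le> (a / pi - of_int m) * pi" "(a / pi - of_int m) * pi < 1 / 2 * pi"
    by (intro mult_right_mono mult_strict_right_mono; simp)+
  moreover have "(a / pi - of_int m) * pi = b" by (simp add: b_def left_diff_distrib)
  ultimately have b: "- (pi / 2) \<le> b" "b < pi / 2" by simp_all
  have s0: "sin (of_int m * pi) = 0" by (metis mult.commute sin_int_times_real sin_npi_int)
  have c0: "cos (of_int m * pi) = (if even m then 1 else -1)"
    by (metis cos_npi_int mult.commute)
  have "cos a = cos (b + of_int m * pi)" by (simp add: b_def)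
  also have "\<dots> = (if even m then 1 else -1) * cos b"
    unfolding cos_add s0 c0 by simp
  finally have eq: "cos a = (if even m then 1 else -1) * cos b" .
  have "cos b \<ge> 0" using b by (intro cos_ge_zero) auto
  moreover have "cos b \<noteq> 0" using eq assms by auto
  ultimately have "cos b > 0" by simp
  thus ?thesis using eq by (simp add: m_def)
qed

theorem sign_changes_of_cosine:
  fixes f :: "nat \<Rightarrow> real"
  assumes x: "0 < x" "x < 1 / 2" and A: "A > 0" and r: "r > 0"
    and lim: "(\<lambda>n. f n * r ^ n - A * cos (2 * pi * x * real n + \<phi>)) \<longlonglongrightarrow> 0"
  shows "(\<lambda>n. real (num_sign_changes (map f [0..<Suc n])) / real n) \<longlonglongrightarrow> 2 * x"
    and "limsup (\<lambda>n. ereal (real n / real (card {m. m < n \<and> f m \<noteq> 0}))) \<le> 2"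
proof -
  define h where "h = 2 * pi * x"
  have h: "0 < h" "h < pi" using x by (auto simp: h_def)
  define \<delta> where "\<delta> = sin h / 4"
  have \<delta>: "\<delta> > 0" using h by (simp add: \<delta>_def sin_gt_zero)
  define a where "a = (\<lambda>n. h * real n + \<phi>)"
  define j where "j = (\<lambda>n. \<lfloor>a n / pi + 1 / 2\<rfloor>)"
  have "A * \<delta> > 0" using A \<delta> by simp
  from order_tendstoD(1)[OF tendsto_minus[OF tendsto_rabs[OF lim]], of "- (A * \<delta>)"] this
  have "eventually (\<lambda>n. - \<bar>f n * r ^ n - A * cos (2 * pi * x * real n + \<phi>)\<bar> > - (A * \<delta>)) sequentially" by simp
  then obtain N where N: "\<And>n. n \<ge> N \<Longrightarrow> \<bar>f n * r ^ n - A * cos (a n)\<bar> < A * \<delta>"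
    unfolding eventually_sequentially a_def h_def by (auto simp: mult.assoc)
  interpret oscillating f "\<lambda>n. cos (a n)" j \<delta> N
  proof
    show "sgn (cos (a n)) = (if even (j n) then 1 else - 1)" if "cos (a n) \<noteq> 0" for n
      using sgn_cos_floor[OF that] by (simp add: j_def)
    \<comment> \<open>\<open>a / pi\<close> advances by \<open>2 x\<close>, which lies strictly
      between \<open>0\<close> and \<open>1\<close>.\<close>
    show "j n \<le> j (Suc n) \<and> j (Suc n) \<le> j n + 1" for n
    proof -
      have "a (Suc n) / pi = a n / pi + 2 * x"
        by (simp add: a_def h_def field_simps)
      thus ?thesis using x unfolding j_def by linarith
    qed
    show "\<delta> \<le> \<bar>cos (a n)\<bar> \<and> \<delta> \<le> \<bar>cos (a (Suc (Suc n)))\<bar> \<and> cos (a n) * cos (a (Suc (Suc n))) < 0"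
      if "\<bar>cos (a (Suc n))\<bar> < \<delta>" for n
    proof -
      have "a n = a (Suc n) - h" "a (Suc (Suc n)) = a (Suc n) + h" by (simp_all add: a_def algebra_simps)
      thus ?thesis using cos_neighbours[OF h \<delta>_def that] by simp
    qed
    show "sgn (f n) = sgn (cos (a n))" if n: "n \<ge> N" and c: "\<bar>cos (a n)\<bar> \<ge> \<delta>" for n
    proof -
      have "A * \<delta> \<le> A * \<bar>cos (a n)\<bar>" using c A by (intro mult_left_mono) auto
      also have "\<dots> = \<bar>A * cos (a n)\<bar>" using A by (simp add: abs_mult)
      finally have "\<bar>f n * r ^ n - A * cos (a n)\<bar> < \<bar>A * cos (a n)\<bar>"
        using N[OF n] by simp
      hence "f n * r ^ n > 0 \<and> A * cos (a n) > 0 \<or> f n * r ^ n < 0 \<and> A * cos (a n) < 0"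
        by linarith
      hence "sgn (f n * r ^ n) = sgn (A * cos (a n))" by (elim disjE conjE) simp_all
      thus ?thesis using A r by (simp add: sgn_mult)
    qed
  qed (rule \<delta>)
  show "limsup (\<lambda>n. ereal (real n / real (card {m. m < n \<and> f m \<noteq> 0}))) \<le> 2"
    by (rule limsup_nonzero_ratio)
  obtain C M where C: "\<And>n. n \<ge> M \<Longrightarrow> \<bar>real (V n) - of_int (j n)\<bar> \<le> C" using V_bounded by blast
  define C' where "C' = C + \<bar>\<phi> / pi\<bar> + 2"
  have "\<bar>real (V n) - 2 * x * real n\<bar> \<le> C'" if "n \<ge> M" for n
  proof -
    have "a n / pi = 2 * x * real n + \<phi> / pi" by (simp add: a_def h_def field_simps)
    hence "\<bar>of_int (j n) - 2 * x * real n\<bar> \<le> \<bar>\<phi> / pi\<bar> + 2" unfolding j_def by linarith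
    thus ?thesis using C[OF that] unfolding C'_def by linarith
  qed
  note V_approx = this
  have "norm (real (V n) / real n - 2 * x) \<le> C' / real n" if "n \<ge> max M 1" for n
  proof -
    have "real (V n) / real n - 2 * x = (real (V n) - 2 * x * real n) / real n"
      using that by (simp add: field_simps)
    thus ?thesis using V_approx[of n] that by (simp add: abs_divide divide_right_mono)
  qed
  hence "eventually (\<lambda>n. norm (real (V n) / real n - 2 * x) \<le> C' / real n) sequentially"
    by (rule eventually_sequentiallyI)
  moreover have "(\<lambda>n. C' / real n) \<longlonglongrightarrow> 0" by (rule lim_const_over_n)
  ultimately have "(\<lambda>n. real (V n) / real n - 2 * x) \<longlonglongrightarrow> 0" by (rule Lim_null_comparison)
  thus "(\<lambda>n. real (num_sign_changes (map f [0..<Suc n])) / real n) \<longlonglongrightarrow> 2 * x"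
    unfolding V_def by (simp add: LIM_zero_iff)
qed

subsection \<open>The highest zero\<close>

lemma less_fps_conv_radius_eisenstein: "r < 1 \<Longrightarrow> ereal r < fps_conv_radius (eisenstein_cfps k)"
  by (rule less_le_trans[OF _ fps_conv_radius_eisenstein]) simp

lemma eisenstein_q_cnj:
  assumes "norm q < 1"
  shows "eisenstein_q k (cnj q) = cnj (eisenstein_q k q)"
proof -
  have "ereal (norm q) < fps_conv_radius (eisenstein_cfps k)"
    using assms by (rule less_fps_conv_radius_eisenstein)
  from sums_eval_fps[OF this]
  have "(\<lambda>n. of_real (eisenstein_coeff k n) * q ^ n) sums eisenstein_q k q"
    by (simp add: eisenstein_q_eq_eval_fps eisenstein_cfps_def)
  hence "(\<lambda>n. cnj (of_real (eisenstein_coeff k n) * q ^ n)) sums cnj (eisenstein_q k q)"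
    by (simp only: sums_cnj)
  thus ?thesis by (simp add: eisenstein_q_def sums_iff)
qed

lemma nome_minus_cnj: "nome (- cnj z) = cnj (nome z)"
  by (simp add: nome_def exp_cnj mult_ac)

lemma eisenstein_minus_cnj:
  "Im z > 0 \<Longrightarrow> eisenstein k (- cnj z) = cnj (eisenstein k z)"
  by (simp add: eisenstein_eq nome_minus_cnj eisenstein_q_cnj norm_nome_less_1)

lemma eisenstein_q_holomorphic: "eisenstein_q k holomorphic_on ball 0 1"
proof -
  have "eval_fps (eisenstein_cfps k) holomorphic_on ball 0 1"
    by (intro holomorphic_on_eval_fps) (auto intro: less_fps_conv_radius_eisenstein)
  thus ?thesis by (simp add: eisenstein_q_eq_eval_fps [abs_def])
qed

lemma eisenstein_has_field_derivative:
  assumes "Im z > 0"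
  shows "(eisenstein k has_field_derivative deriv (eisenstein_q k) (nome z) * (2 * of_real pi * \<i> * nome z)) (at z)"
proof -
  have "(eisenstein_q k has_field_derivative deriv (eisenstein_q k) (nome z)) (at (nome z))"
    using holomorphic_derivI[OF eisenstein_q_holomorphic] norm_nome_less_1[OF assms] by simp
  from DERIV_chain2[OF this nome_has_field_derivative] show ?thesis
    by (simp add: eisenstein_eq [abs_def])
qed

lemma nome_diff_of_int: "nome (z - of_int n) = nome z"
proof -
  have "nome (z - of_int n) = nome z * exp (- (of_int n * (2 * of_real pi * \<i>)))"
    unfolding nome_def mult_exp_exp by (simp add: algebra_simps)
  also have "exp (- (of_int n * (2 * of_real pi * \<i>))) = 1"
    using exp_integer_2pi[of "- of_int n"] by (simp add: mult_ac)
  finally show ?thesis by simp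
qed

section \<open>A zero on the unit circle\<close>

context high_weight
begin

lemma power_k: "x ^ k = x ^ m * (x ^ m :: complex)"
  by (simp only: k_eq mult_2 power_add)

definition arc :: "real \<Rightarrow> complex" where "arc t = \<i> * cis (- t)"

lemma arc_simps [simp]: "Re (arc t) = sin t" "Im (arc t) = cos t" "norm (arc t) = 1"
  by (simp_all add: arc_def norm_mult)

text \<open>On the circle \<open>- 1 / z = - cnj z\<close>, so inversion and reflection combine to
  \<open>cnj (E z) = z^k * E z\<close>; half of this power makes \<open>z^m * E z\<close> equal to
  its conjugate.\<close>

lemma arc_real:
  assumes "cos t > 0"
  shows "Im (arc t ^ m * eisenstein k (arc t)) = 0"
proof -
  have I: "Im (arc t) > 0" using assms by simp
  have a0: "arc t \<noteq> 0" using arc_simps(3)[of t] by (metis norm_zero zero_neq_one)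
  have c: "arc t * cnj (arc t) = 1"
    using complex_norm_square[of "arc t"] by simp
  hence "- 1 / arc t = - cnj (arc t)" using a0 by (simp add: field_simps)
  hence "cnj (eisenstein k (arc t)) = arc t ^ k * eisenstein k (arc t)"
    using eisenstein_inversion[OF I even_k] k_ge eisenstein_minus_cnj[OF I] by simp
  hence "cnj (arc t ^ m * eisenstein k (arc t)) = (arc t * cnj (arc t)) ^ m * (arc t ^ m * eisenstein k (arc t))"
    by (simp add: power_k power_mult_distrib mult_ac)
  also have "\<dots> = arc t ^ m * eisenstein k (arc t)" by (simp add: c)
  finally show ?thesis by (metis Reals_cnj_iff complex_is_Real_iff)
qed

lemma i_power_m: "\<i> ^ m = of_real ((-1) ^ (m div 2))"
proof -
  obtain l where l: "m = 2 * l" using even_m by auto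
  show ?thesis by (simp add: l power_mult)
qed

text \<open>Since \<open>\<i>^m\<close> is the sign \<open>(-1) ^ (m div 2)\<close>, multiplication
  by \<open>z^m\<close> turns \<open>1 + z^-k\<close> into that sign times
  \<open>2 cos (m t)\<close>. The error is the tail, bounded as in the contraction estimate.\<close>

lemma arc_value:
  assumes "5 * pi / 6 \<le> real k * t" "real k * t \<le> 7 * pi / 6"
  shows "\<bar>(-1) ^ (m div 2) * Re (arc t ^ m * eisenstein k (arc t)) - 2 * cos (real m * t)\<bar> \<le> 205 / 1000"
proof -
  have z: "arc t = of_real 1 * (\<i> * cis (- t))" by (simp add: arc_def)
  note f = zone_facts[OF z order.refl _ assms, simplified]
  have I: "Im (arc t) > 0" using f by simp
  have rest: "norm (eisenstein_rest k (arc t)) \<le> 205 / 1000"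
  proof -
    have "norm (eisenstein_rest k (arc t)) \<le> (58 / 1000 + 1 / (138 / 100) ^ 6) / (138 / 100) ^ (m - 6)"
      by (rule norm_eisenstein_rest_le[of _ _ m, unfolded fold_k]) (use f m_ge in auto)
    also have "\<dots> \<le> (58 / 1000 + 1 / (138 / 100) ^ 6) / 1"
      by (intro divide_left_mono) auto
    also have "\<dots> \<le> 205 / 1000" by (simp add: power_numeral_reduce)
    finally show ?thesis .
  qed
  have a0: "arc t \<noteq> 0" using arc_simps(3)[of t] by (metis norm_zero zero_neq_one)
  define \<epsilon> :: real where "\<epsilon> = (-1) ^ (m div 2)"
  have e: "\<epsilon> * \<epsilon> = 1" "\<bar>\<epsilon>\<bar> = 1"
    by (auto simp: \<epsilon>_def power_abs simp flip: power_mult_distrib)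
  have am: "arc t ^ m = of_real \<epsilon> * cis (- (real m * t))"
    using Complex.DeMoivre[of "- t" m] i_power_m by (simp add: arc_def power_mult_distrib \<epsilon>_def)
  have "arc t ^ m * eisenstein k (arc t) = arc t ^ m + arc t ^ m / arc t ^ k + arc t ^ m * eisenstein_rest k (arc t)"
    using eisenstein_eq_rest[OF I] by (simp add: algebra_simps)
  also have "arc t ^ m / arc t ^ k = inverse (arc t ^ m)"
    using a0 by (simp add: power_k field_simps)
  also have "\<dots> = of_real \<epsilon> * cis (real m * t)"
  proof -
    have "inverse (of_real \<epsilon>) = complex_of_real \<epsilon>" using e(1) 
      by (metis inverse_unique of_real_1 of_real_mult)
    thus ?thesis unfolding am by simp
  qed
  finally have "Re (arc t ^ m * eisenstein k (arc t)) = \<epsilon> * (2 * cos (real m * t)) + Re (arc t ^ m * eisenstein_rest k (arc t))"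
    by (simp add: am)
  hence "\<epsilon> * Re (arc t ^ m * eisenstein k (arc t)) - 2 * cos (real m * t) = \<epsilon> * Re (arc t ^ m * eisenstein_rest k (arc t))"
    using e(1) by (simp add: distrib_left flip: mult.assoc)
  hence "\<bar>\<epsilon> * Re (arc t ^ m * eisenstein k (arc t)) - 2 * cos (real m * t)\<bar> = \<bar>Re (arc t ^ m * eisenstein_rest k (arc t))\<bar>"
    using e(2) by (simp add: abs_mult)
  also have "\<dots> \<le> norm (arc t ^ m * eisenstein_rest k (arc t))" by (rule abs_Re_le_cmod)
  also have "\<dots> \<le> 205 / 1000" using rest by (simp add: norm_mult norm_power)
  finally show ?thesis by (simp add: \<epsilon>_def)
qed

lemma cos_5pi_12: "cos (5 * pi / 12) \<ge> 1 / 4"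
proof -
  have "cos (5 * pi / 6) = cos (pi - pi / 6)" by (simp add: field_simps)
  also have "\<dots> = - (sqrt 3 / 2)" unfolding cos_diff by (simp add: cos_30)
  finally have "2 * (cos (5 * pi / 12))\<^sup>2 - 1 = - (sqrt 3 / 2)"
    using cos_double_cos[of "5 * pi / 12"] by simp
  moreover have "sqrt 3 \<le> 174 / 100" by (rule real_le_lsqrt) (auto simp: power2_eq_square)
  ultimately have "(1 / 4)\<^sup>2 \<le> (cos (5 * pi / 12))\<^sup>2" by (simp add: power_divide)
  moreover have "cos (5 * pi / 12) \<ge> 0" by (rule cos_ge_zero) auto
  ultimately show ?thesis by (rule power2_le_imp_le)
qed

text \<open>Across the bracket \<open>m t\<close> runs from \<open>5 pi / 12\<close> to
  \<open>7 pi / 12\<close>, where \<open>2 cos\<close> is at least \<open>1/2\<close> and at most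
  \<open>-1/2\<close>; an error of \<open>205/1000\<close> cannot undo the sign change.\<close>

lemma arc_zero_exists:
  obtains t where "5 * pi / 6 \<le> real k * t" "real k * t \<le> 7 * pi / 6" "eisenstein k (arc t) = 0"
proof -
  define \<epsilon> :: real where "\<epsilon> = (-1) ^ (m div 2)"
  have e: "\<epsilon> \<noteq> 0" by (simp add: \<epsilon>_def)
  define \<phi> where "\<phi> = (\<lambda>t. \<epsilon> * Re (arc t ^ m * eisenstein k (arc t)))"
  define a where "a = 5 * pi / 6 / real k"
  define b where "b = 7 * pi / 6 / real k"
  have k0: "real k > 0" using k_ge by simp
  have rk: "real k = 2 * real m" by (subst k_eq) simp
  have kt: "5 * pi / 6 \<le> real k * t" "real k * t \<le> 7 * pi / 6" if "a \<le> t" "t \<le> b" for t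
    using that k0 by (auto simp: a_def b_def field_simps)
  have ab: "a \<le> b" unfolding a_def b_def using k0 by (intro divide_right_mono) auto
  have cos_pos: "cos t > 0" if "a \<le> t" "t \<le> b" for t
  proof -
    have z: "arc t = of_real 1 * (\<i> * cis (- t))" by (simp add: arc_def)
    have "95 / 100 \<le> cos t" by (rule zone_facts(5)[OF z order.refl _ kt[OF that]]) simp
    thus ?thesis by linarith
  qed
  have ma: "real m * a = 5 * pi / 12" and mb: "real m * b = 7 * pi / 12"
    using k0 unfolding a_def b_def rk by auto
  have cb: "cos (7 * pi / 12) = - cos (5 * pi / 12)"
  proof -
    have "cos (7 * pi / 12) = cos (pi - 5 * pi / 12)" by (simp add: field_simps)
    thus ?thesis unfolding cos_diff by simp
  qed
  have "0 \<le> \<phi> a" "\<phi> b \<le> 0"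
    using arc_value[OF kt[OF order.refl ab]] arc_value[OF kt[OF ab order.refl]] cos_5pi_12
    unfolding \<phi>_def \<epsilon>_def ma mb cb by linarith+
  moreover have "continuous_on {a..b} \<phi>"
  proof -
    have "continuous_on {z. Im z > 0} (eisenstein k)"
      by (rule continuous_at_imp_continuous_on) (auto intro: DERIV_isCont[OF eisenstein_has_field_derivative])
    moreover have "continuous_on {a..b} arc" unfolding arc_def by (intro continuous_intros)
    ultimately have "continuous_on {a..b} (\<lambda>t. eisenstein k (arc t))"
      by (rule continuous_on_compose2) (use cos_pos in auto)
    with \<open>continuous_on {a..b} arc\<close> show ?thesis
      unfolding \<phi>_def by (intro continuous_intros)
  qed
  ultimately obtain t where t: "a \<le> t" "t \<le> b" "\<phi> t = 0"
    using IVT2'[of \<phi> b 0 a] ab by auto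
  have "Re (arc t ^ m * eisenstein k (arc t)) = 0" using t(3) e by (simp add: \<phi>_def)
  with arc_real[OF cos_pos[OF t(1,2)]] have "arc t ^ m * eisenstein k (arc t) = 0"
    by (simp add: complex_eq_iff)
  moreover have "arc t \<noteq> 0" using arc_simps(3)[of t] by (metis norm_zero zero_neq_one)
  ultimately have "eisenstein k (arc t) = 0" by simp
  with kt[OF t(1,2)] show ?thesis using that by blast
qed

lemma zero_unique:
  assumes "Im z > 0" "0 \<le> Re z" "Re z \<le> 1 / 2" "1 \<le> norm z" "cos low_angle \<le> Im z" "eisenstein k z = 0"
    and "Im w > 0" "0 \<le> Re w" "Re w \<le> 1 / 2" "1 \<le> norm w" "cos low_angle \<le> Im w" "eisenstein k w = 0"
  shows "z = w"
proof -
  obtain u v where "u \<in> zone" "z = zone_map u" "v \<in> zone" "w = zone_map v"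
    using zero_in_zone[OF assms(1-6)] zero_in_zone[OF assms(7-12)] by blast
  thus ?thesis using eisenstein_zone_map_expanding[of u v] assms(6,12) by auto
qed

section \<open>All zeros at or above the height of the zero on the circle\<close>

definition top_zero :: "complex \<Rightarrow> bool" where
  "top_zero z \<longleftrightarrow> 0 < Re z \<and> Re z < 1 / 2 \<and> norm z = 1 \<and> cos low_angle \<le> Im z \<and> eisenstein k z = 0"

lemma top_zero_exists: "\<exists>z. top_zero z"
proof -
  obtain t where t: "5 * pi / 6 \<le> real k * t" "real k * t \<le> 7 * pi / 6" "eisenstein k (arc t) = 0"
    by (rule arc_zero_exists)
  have z: "arc t = of_real 1 * (\<i> * cis (- t))" by (simp add: arc_def)
  note f = zone_facts[OF z order.refl _ t(1,2), simplified]
  have "cos low_angle \<le> cos t" using f low_angle by (intro cos_monotone_0_pi_le) auto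
  moreover have "sin t < 1 / 2"
  proof (rule ccontr)
    assume "\<not> sin t < 1 / 2"
    hence "(1 / 2)\<^sup>2 \<le> (sin t)\<^sup>2" by (intro power_mono) auto
    moreover have "(95 / 100)\<^sup>2 \<le> (cos t)\<^sup>2" using f by (intro power_mono) auto
    ultimately show False using sin_cos_squared_add[of t] by (simp add: power2_eq_square)
  qed
  ultimately show ?thesis using f t(3) unfolding top_zero_def by (intro exI[of _ "arc t"]) auto
qed

context
  fixes z0 assumes z0: "top_zero z0"
begin

lemma z0_facts: "0 < Re z0" "Re z0 < 1 / 2" "norm z0 = 1" "cos low_angle \<le> Im z0" "eisenstein k z0 = 0" 
    "95 / 100 \<le> Im z0" "0 < Im z0"
  using z0 cos_low_angle(2) unfolding top_zero_def by auto

text \<open>A zero \<open>u\<close> inside the unit disc would be mirrored in the circle to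
  \<open>w = u / |u|^2\<close>, again a zero, no lower and in the same half strip. Uniqueness gives
  \<open>w = z0\<close>, but \<open>|w| > 1\<close>.\<close>

lemma zero_in_half_strip:
  assumes u: "0 \<le> Re u" "Re u \<le> 1 / 2" "Im z0 \<le> Im u" "eisenstein k u = 0"
  shows "u = z0"
proof (cases "norm u \<ge> 1")
  case True
  show ?thesis by (rule zero_unique) (use True z0_facts u in auto)
next
  case False
  have Iu: "Im u \<ge> 95 / 100" using u z0_facts by linarith
  define s where "s = (norm u)\<^sup>2"
  have s: "s < 1" "s = (Re u)\<^sup>2 + (Im u)\<^sup>2"
  proof -
    show "s < 1" unfolding s_def by (rule power_less_one_iff[THEN iffD2]) (use False in auto)
    show "s = (Re u)\<^sup>2 + (Im u)\<^sup>2" unfolding s_def by (rule cmod_power2)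
  qed
  have "(95 / 100)\<^sup>2 \<le> (Im u)\<^sup>2" using Iu by (intro power_mono) auto
  hence I2: "9025 / 10000 \<le> (Im u)\<^sup>2" by (simp add: power2_eq_square)
  hence s9: "9025 / 10000 \<le> s" using s(2) zero_le_power2[of "Re u"] by linarith
  \<comment> \<open>From \<open>|u| < 1\<close> and \<open>Im u \<ge> 0.95\<close>; since
    \<open>s \<ge> 0.9025\<close>, this keeps \<open>Re w = Re u / s\<close> below
    \<open>1/2\<close>.\<close>
  have R: "Re u \<le> 4 / 10"
  proof (rule ccontr)
    assume "\<not> Re u \<le> 4 / 10"
    hence "(4 / 10)\<^sup>2 \<le> (Re u)\<^sup>2" by (intro power_mono) auto
    hence "16 / 100 \<le> (Re u)\<^sup>2" by (simp add: power2_eq_square)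
    thus False using s I2 by linarith
  qed
  have u0: "u \<noteq> 0" using Iu by auto
  define w where "w = u / of_real s"
  have w: "w = - cnj (- 1 / u)"
    using u0 complex_norm_square[of u] by (simp add: w_def s_def field_simps)
  have Iu0: "Im u > 0" using Iu by linarith
  have s0: "s > 0" using s9 by linarith
  have Iw: "Im w = Im u / s" "Re w = Re u / s" using s0 by (simp_all add: w_def Im_divide_of_real Re_divide_of_real)
  have "Im u * s \<le> Im u * 1" using s Iu0 by (intro mult_left_mono) auto
  hence Iwu: "Im u \<le> Im w" using s0 unfolding Iw by (simp add: field_simps)
  have Rw: "0 \<le> Re w" "Re w \<le> 1 / 2" using s0 s9 R u unfolding Iw by (auto simp: divide_simps)
  have nu: "norm u < 1" "norm u > 0" using False u0 by auto
  have nw: "norm w > 1"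
  proof -
    have "norm w = 1 / norm u" using u0 s0 by (simp add: w_def norm_divide norm_mult s_def power2_eq_square)
    thus ?thesis using nu by simp
  qed
  have "Im (- 1 / u) > 0"
  proof -
    have "Im (- cnj v) = Im v" for v by simp
    hence "Im w = Im (- 1 / u)" unfolding w .
    thus ?thesis using Iwu Iu0 by linarith
  qed
  hence "eisenstein k w = cnj (eisenstein k (- 1 / u))"
    unfolding w by (rule eisenstein_minus_cnj)
  also have "\<dots> = 0" using eisenstein_inversion[OF Iu0 even_k] k_ge u(4) by simp
  finally have Ew: "eisenstein k w = 0" .
  have "w = z0"
    by (rule zero_unique) (use Iwu Iu0 Rw nw z0_facts u Ew in auto)
  thus ?thesis using nw z0_facts by simp
qed

text \<open>Subtracting the integer nearest to \<open>Re w\<close> and, if needed, reflecting in the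
  imaginary axis moves a zero into the right half strip at the same height.\<close>

lemma zeros_above:
  assumes w: "Im z0 \<le> Im w" "eisenstein k w = 0"
  obtains n :: int where "w = z0 + of_int n \<or> w = - cnj z0 + of_int n"
proof -
  define n where "n = round (Re w)"
  define u where "u = w - of_int n"
  have R: "\<bar>Re u\<bar> \<le> 1 / 2"
    using of_int_round_abs_le[of "Re w"] by (simp add: u_def n_def abs_minus_commute)
  have Iu: "Im u = Im w" by (simp add: u_def)
  have Eu: "eisenstein k u = 0" using w by (simp add: u_def eisenstein_eq nome_diff_of_int)
  show ?thesis
  proof (cases "Re u \<ge> 0")
    case True
    hence "u = z0" using R Iu Eu w by (intro zero_in_half_strip) auto
    hence "w = z0 + of_int n" by (simp add: u_def diff_eq_eq)
    thus ?thesis using that[of n] by simp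
  next
    case False
    have "Im u > 0" using Iu w z0_facts by simp
    hence "eisenstein k (- cnj u) = 0" using Eu by (simp add: eisenstein_minus_cnj)
    hence "- cnj u = z0" using False R Iu w by (intro zero_in_half_strip) auto
    hence "u = - cnj z0" by auto
    hence "w = - cnj z0 + of_int n" by (simp add: u_def diff_eq_eq)
    thus ?thesis using that[of n] by simp
  qed
qed

lemma highest_zero_eq: "highest_zero k = z0"
proof -
  have dom: "z0 \<in> std_fund_domain" using z0_facts by (simp add: std_fund_domain_def)
  have le: "Im w \<le> Im z0" if "eisenstein k w = 0" for w
  proof (rule ccontr)
    assume "\<not> Im w \<le> Im z0"
    thus False using zeros_above[of w] that by fastforce
  qed
  have "is_highest_zero k z0"
    unfolding is_highest_zero_def using dom z0_facts le by auto
  moreover have "y = z0" if y: "is_highest_zero k y" for y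
  proof -
    have yd: "y \<in> std_fund_domain" "eisenstein k y = 0" and "Im z0 \<le> Im y"
      using y dom z0_facts unfolding is_highest_zero_def by auto
    obtain n :: int where n: "y = z0 + of_int n \<or> y = - cnj z0 + of_int n"
      using zeros_above[OF \<open>Im z0 \<le> Im y\<close> yd(2)] .
    have Ry: "- (1 / 2) < Re y" "Re y \<le> 1 / 2" and neg: "Re y < 0 \<Longrightarrow> norm y > 1"
      using yd(1) by (auto simp: std_fund_domain_def)
    from n show ?thesis
    proof
      assume y: "y = z0 + of_int n"
      hence "- 1 < real_of_int n" "real_of_int n < 1" using Ry z0_facts by simp_all
      thus ?thesis using y by simp
    next
      \<comment> \<open>The mirror image of \<open>z0\<close> lies on the arc with negative real
        part, which the fundamental domain excludes; this makes the description by
        \<open>THE\<close> unambiguous.\<close>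
      assume y: "y = - cnj z0 + of_int n"
      hence "- 1 < real_of_int n" "real_of_int n < 1" using Ry z0_facts by simp_all
      hence "n = 0" by simp
      hence "Re y < 0" "norm y = 1" using y z0_facts by simp_all
      thus ?thesis using neg by simp
    qed
  qed
  ultimately show ?thesis unfolding highest_zero_def by (intro the_equality)
qed

text \<open>A zero derivative contradicts the expansion inequality. As \<open>norm z0 = 1\<close>
  means \<open>norm (1 - v) = 1\<close>, the point \<open>v\<close> lies on the boundary of
  \<open>zone\<close>; the difference quotients are therefore taken within \<open>zone\<close>, of
  which \<open>v\<close> is a limit point by connectedness.\<close>

lemma deriv_eisenstein_q_nonzero: "deriv (eisenstein_q k) (nome z0) \<noteq> 0"
proof
  assume "deriv (eisenstein_q k) (nome z0) = 0"
  hence d: "(eisenstein k has_field_derivative 0) (at z0)"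
    using eisenstein_has_field_derivative[OF z0_facts(7), of k] by simp
  obtain v where v: "v \<in> zone" "z0 = zone_map v"
    using zero_in_zone[of z0] z0_facts by auto
  have "((eisenstein k \<circ> zone_map) has_field_derivative 0 * (zone_map v / (of_nat k * (1 - v)))) (at v within zone)"
    using d unfolding v(2) by (rule DERIV_chain) (rule zone_map_has_field_derivative[OF v(1)])
  hence "((\<lambda>u. ((eisenstein k \<circ> zone_map) u - (eisenstein k \<circ> zone_map) v) / (u - v)) \<longlongrightarrow> 0) (at v within zone)"
    unfolding has_field_derivative_iff by simp
  hence "eventually (\<lambda>u. norm (((eisenstein k \<circ> zone_map) u - (eisenstein k \<circ> zone_map) v) / (u - v)) < 1 / 2) (at v within zone)"
    unfolding tendsto_iff by (auto simp: dist_norm dest!: spec[of _ "1 / 2"])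
  moreover have "eventually (\<lambda>u. u \<in> zone \<and> u \<noteq> v) (at v within zone)"
    by (simp add: eventually_at_filter)
  ultimately have "eventually (\<lambda>u. False) (at v within zone)"
  proof eventually_elim
    case (elim u)
    have "1 / 2 * norm (u - v) \<le> norm (eisenstein k (zone_map u) - eisenstein k (zone_map v))"
      by (rule eisenstein_zone_map_expanding) (use elim v in auto)
    hence "1 / 2 \<le> norm ((eisenstein k (zone_map u) - eisenstein k (zone_map v)) / (u - v))"
      using elim by (simp add: norm_divide field_simps)
    thus ?case using elim by simp
  qed
  hence "\<not> v islimpt zone" by (simp add: trivial_limit_within eventually_False)
  moreover have "v islimpt zone"
  proof (rule connected_imp_perfect)
    show "connected zone" by (rule convex_connected[OF convex_zone])
    have "0 \<in> zone" "1 / 2 \<in> zone" by (auto simp: zone_iff)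
    thus "zone \<noteq> {x}" for x by (metis divide_eq_0_iff singletonD zero_neq_numeral zero_neq_one)
  qed fact
  ultimately show False by contradiction
qed

section \<open>The poles of the reciprocal in the variable \<open>q\<close>\<close>

lemma eisenstein_q_0: "eisenstein_q k 0 = 1"
  by (simp add: eisenstein_q_eq_eval_fps eval_fps_at_0 eisenstein_cfps_def eisenstein_coeff_def)

text \<open>The modulus of \<open>nome w\<close> depends only on \<open>Im w\<close>, so any
  logarithm of \<open>q\<close> lies at least as high as \<open>z0\<close>; integer translations
  disappear under \<open>nome\<close>.\<close>

lemma eisenstein_q_zeros:
  assumes "norm q \<le> norm (nome z0)" "eisenstein_q k q = 0"
  shows "q = nome z0 \<or> q = cnj (nome z0)"
proof -
  have q0: "q \<noteq> 0" using assms(2) eisenstein_q_0 by auto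
  define w where "w = Ln q / (2 * of_real pi * \<i>)"
  have q: "nome w = q" using q0 by (simp add: nome_def w_def)
  have "norm (nome w) \<le> norm (nome z0)" using assms(1) q by simp
  hence "Im z0 \<le> Im w" by (simp add: norm_nome)
  moreover have "eisenstein k w = 0" using assms(2) q by (simp add: eisenstein_eq)
  ultimately obtain n :: int where "w = z0 + of_int n \<or> w = - cnj z0 + of_int n"
    by (rule zeros_above)
  hence "nome w = nome z0 \<or> nome w = nome (- cnj z0)"
    using nome_diff_of_int[of w n] by auto
  thus ?thesis by (simp add: q nome_minus_cnj)
qed

text \<open>\<open>0 < 2 pi Re z0 < pi\<close> puts the exponent in the principal strip, so its
  imaginary part is the argument, and the pole is not real.\<close>

lemma nome_z0: "Arg (nome z0) = 2 * pi * Re z0" "Im (nome z0) \<noteq> 0"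
proof -
  have x: "0 < 2 * pi * Re z0" "2 * pi * Re z0 < pi" using z0_facts by auto
  have im: "Im (2 * of_real pi * \<i> * z0) = 2 * pi * Re z0" by simp
  have "Ln (nome z0) = 2 * of_real pi * \<i> * z0"
    unfolding nome_def by (rule Ln_exp; unfold im; use x pi_gt_zero in linarith)
  thus "Arg (nome z0) = 2 * pi * Re z0" by (simp add: Arg_eq_Im_Ln nome_def)
  have "Im (nome z0) = exp (- (2 * pi * Im z0)) * sin (2 * pi * Re z0)"
    by (simp add: nome_def Im_exp)
  moreover have "sin (2 * pi * Re z0) > 0" using x by (intro sin_gt_zero) auto
  ultimately show "Im (nome z0) \<noteq> 0" by simp
qed

lemma recip_coeff_asymptotics:
  obtains A \<phi> where "A > 0"
    "(\<lambda>n. recip_coeff k n * norm (nome z0) ^ n - A * cos (2 * pi * Re z0 * real n + \<phi>)) \<longlonglongrightarrow> 0"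
proof -
  have exp: "eisenstein_q k has_fps_expansion Abs_fps (\<lambda>n. of_real (fps_nth (eisenstein_fps k) n))"
  proof -
    have "fps_conv_radius (eisenstein_cfps k) > 0"
      using less_fps_conv_radius_eisenstein[of 0 k] by (simp add: zero_ereal_def)
    hence "eval_fps (eisenstein_cfps k) has_fps_expansion eisenstein_cfps k"
      by (rule eval_fps_has_fps_expansion)
    thus ?thesis
      by (simp add: eisenstein_q_eq_eval_fps [abs_def] eisenstein_cfps_def eisenstein_fps_def)
  qed
  have z: "eisenstein_q k (nome z0) = 0" using z0_facts(5) by (simp add: eisenstein_eq)
  have F0: "fps_nth (eisenstein_fps k) 0 \<noteq> 0"
    by (simp add: eisenstein_fps_def eisenstein_coeff_def)
  obtain A \<phi> where A: "A > 0" 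
    and lim: "(\<lambda>n. fps_nth (inverse (eisenstein_fps k)) n * norm (nome z0) ^ n 
                - A * cos (real n * Arg (nome z0) + \<phi>)) \<longlonglongrightarrow> 0"
    by (rule recip_coeff_conjugate_pole_asymptotics[OF eisenstein_q_holomorphic exp eisenstein_q_cnj F0
          norm_nome_less_1[OF z0_facts(7)] nome_z0(2) z deriv_eisenstein_q_nonzero eisenstein_q_zeros])
  have "(\<lambda>n. recip_coeff k n * norm (nome z0) ^ n - A * cos (2 * pi * Re z0 * real n + \<phi>)) \<longlonglongrightarrow> 0"
    using lim unfolding recip_coeff_def nome_z0(1) by (simp only: mult_ac)
  with A show ?thesis by (rule that)
qed

end

end

theorem theorem6:
  fixes k :: nat
  assumes "k \<ge> 12" and "k mod 4 = 0"
  shows "((\<lambda>n. real (recip_sign_changes k n) / real n) \<longlonglongrightarrow> 2 * Re (highest_zero k)) \<and>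
         limsup (\<lambda>n. ereal (real n / real (recip_nonzero_count k n))) \<le> 2"
proof -
  interpret high_weight k "k div 2"
    by unfold_locales (use assms in presburger)+
  obtain z0 where z0: "top_zero z0" using top_zero_exists by blast
  obtain A \<phi> where A: "A > 0"
    and lim: "(\<lambda>n. recip_coeff k n * norm (nome z0) ^ n - A * cos (2 * pi * Re z0 * real n + \<phi>)) \<longlonglongrightarrow> 0"
    by (rule recip_coeff_asymptotics[OF z0])
  have r: "norm (nome z0) > 0" by (simp add: nome_def)
  have "recip_sign_changes k n = num_sign_changes (map (recip_coeff k) [0..<Suc n])" for n
    by (simp add: recip_sign_changes_def)
  moreover have "recip_nonzero_count k n = card {m. m < n \<and> recip_coeff k m \<noteq> 0}" for n
    by (simp add: recip_nonzero_count_def)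
  ultimately show ?thesis
    using sign_changes_of_cosine[OF z0_facts(1,2)[OF z0] A r lim] highest_zero_eq[OF z0] by simp
qed

end
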